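(* Let $f\in L^2(\mathbb{C})$. Then $$\int_{\mathbb{C}}|Zf(z)|^2\,dz+\int_{\mathbb{C}}|\bar{Z}f(z)|^2\,dz\;\geq\; 8\pi\|f\|_2^2 .$$
   Context: Write $z=x+iy\in\mathbb{C}$, identify $\mathbb{C}$ with $\mathbb{R}^2$, and let $dz=dx\,dy$ be Lebesgue measure. The operators $Z$ and $\bar Z$ are $$Z=\frac{d}{dz}+2\pi\bar z,\qquad \bar Z=\frac{d}{d\bar z}-2\pi z,$$ where $\frac{d}{dz}=\frac{\partial}{\partial x}-i\frac{\partial}{\partial y}$ and $\frac{d}{d\bar z}=\frac{\partial}{\partial x}+i\frac{\partial}{\partial y}$, so that $[Z,\bar Z]=Z\bar Z-\bar ZZ=-8\pi I$. Derivatives are taken in the sense of distributions, and an integral $\int|Zf|^2$ (or $\int |\bar Z f|^2$) is $+\infty$ when $Zf$ (or $\bar Zf$) is not in $L^2(\mathbb{C})$. *)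

theory Defs
  imports "HOL-Analysis.Analysis"
begin

text \<open>Real partial derivatives of functions on the complex plane, identified with
  the real plane; only meaningful where the function is real-differentiable.\<close>

definition partial_x :: "(complex \<Rightarrow> complex) \<Rightarrow> complex \<Rightarrow> complex" where
  "partial_x \<phi> z = frechet_derivative \<phi> (at z) 1"

definition partial_y :: "(complex \<Rightarrow> complex) \<Rightarrow> complex \<Rightarrow> complex" where
  "partial_y \<phi> z = frechet_derivative \<phi> (at z) \<i>"

text \<open>Differentiability in the real sense, not holomorphy.\<close>

fun Ck :: "nat \<Rightarrow> (complex \<Rightarrow> complex) \<Rightarrow> bool" where
  "Ck 0 \<phi> \<longleftrightarrow> continuous_on UNIV \<phi>"
| "Ck (Suc k) \<phi> \<longleftrightarrow>
     (\<forall>z. \<phi> differentiable (at z)) \<and> Ck k (partial_x \<phi>) \<and> Ck k (partial_y \<phi>)"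

definition test_function :: "(complex \<Rightarrow> complex) \<Rightarrow> bool" where
  "test_function \<phi> \<longleftrightarrow> (\<forall>k. Ck k \<phi>) \<and> compact (closure {z. \<phi> z \<noteq> 0})"

text \<open>A distribution is represented by its pairing with test functions; its values on
  other functions are irrelevant.  The pairing is bilinear (no complex conjugation).
  Linearity and continuity are not recorded in the type: they hold for the distribution
  of a locally integrable function and are preserved by the operations below.\<close>

type_synonym distribution = "(complex \<Rightarrow> complex) \<Rightarrow> complex"

definition distr_of :: "(complex \<Rightarrow> complex) \<Rightarrow> distribution" where
  "distr_of f \<phi> = (\<integral>z. f z * \<phi> z \<partial>lebesgue)"

definition distr_dx :: "distribution \<Rightarrow> distribution" where
  "distr_dx u \<phi> = - u (partial_x \<phi>)"

definition distr_dy :: "distribution \<Rightarrow> distribution" where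
  "distr_dy u \<phi> = - u (partial_y \<phi>)"

definition distr_mult :: "(complex \<Rightarrow> complex) \<Rightarrow> distribution \<Rightarrow> distribution" where
  "distr_mult a u \<phi> = u (\<lambda>z. a z * \<phi> z)"

text \<open>The derivatives with respect to \<open>z\<close> and its conjugate are taken without
  the customary factor 1/2.\<close>

definition distr_dz :: "distribution \<Rightarrow> distribution" where
  "distr_dz u \<phi> = distr_dx u \<phi> - \<i> * distr_dy u \<phi>"

definition distr_dzbar :: "distribution \<Rightarrow> distribution" where
  "distr_dzbar u \<phi> = distr_dx u \<phi> + \<i> * distr_dy u \<phi>"

definition Z_op :: "distribution \<Rightarrow> distribution" where
  "Z_op u \<phi> = distr_dz u \<phi> + distr_mult (\<lambda>z. 2 * of_real pi * cnj z) u \<phi>"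

definition Zbar_op :: "distribution \<Rightarrow> distribution" where
  "Zbar_op u \<phi> = distr_dzbar u \<phi> - distr_mult (\<lambda>z. 2 * of_real pi * z) u \<phi>"

definition in_L2 :: "(complex \<Rightarrow> complex) \<Rightarrow> bool" where
  "in_L2 f \<longleftrightarrow> f \<in> borel_measurable lebesgue \<and> integrable lebesgue (\<lambda>z. (cmod (f z))\<^sup>2)"

definition L2_norm :: "(complex \<Rightarrow> complex) \<Rightarrow> real" where
  "L2_norm f = sqrt (\<integral>z. (cmod (f z))\<^sup>2 \<partial>lebesgue)"

definition L2_represents :: "(complex \<Rightarrow> complex) \<Rightarrow> distribution \<Rightarrow> bool" where
  "L2_represents g u \<longleftrightarrow> in_L2 g \<and> (\<forall>\<phi>. test_function \<phi> \<longrightarrow> u \<phi> = distr_of g \<phi>)"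

text \<open>The integral of \<open>|u|\<^sup>2\<close> for a distribution \<open>u\<close>, infinite if \<open>u\<close> is not in
  \<open>L\<^sup>2\<close>.  The choice of representative is immaterial, since it is unique almost
  everywhere.\<close>

definition integral_abs_sq :: "distribution \<Rightarrow> ennreal" where
  "integral_abs_sq u =
     (if \<exists>g. L2_represents g u
      then \<integral>\<^sup>+z. ennreal ((cmod ((SOME g. L2_represents g u) z))\<^sup>2) \<partial>lebesgue
      else \<infinity>)"

end

theory Submission imports Defs begin

text \<open>In real terms \<open>Z f = D\<^sub>x f - \<i> D\<^sub>y f\<close> and \<open>Zbar f = D\<^sub>x f + \<i> D\<^sub>y f\<close> with the magnetic
derivatives \<open>D\<^sub>x = \<partial>\<^sub>x - 2\<pi>\<i>y\<close> and \<open>D\<^sub>y = \<partial>\<^sub>y + 2\<pi>\<i>x\<close>.  By the parallelogram law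
\<open>\<parallel>Z f\<parallel>\<^sup>2 + \<parallel>Zbar f\<parallel>\<^sup>2 = 2\<parallel>D\<^sub>x f\<parallel>\<^sup>2 + 2\<parallel>D\<^sub>y f\<parallel>\<^sup>2 \<ge> 4\<parallel>D\<^sub>x f\<parallel>\<parallel>D\<^sub>y f\<parallel>\<close>, and since
\<open>[D\<^sub>x, D\<^sub>y] = 4\<pi>\<i>\<close>, the bound \<open>8\<pi>\<parallel>f\<parallel>\<^sup>2\<close> is the Heisenberg uncertainty principle
\<open>2\<pi>\<parallel>f\<parallel>\<^sup>2 \<le> \<parallel>D\<^sub>x f\<parallel>\<parallel>D\<^sub>y f\<parallel>\<close>.

For an \<open>f\<close> whose derivatives exist only weakly the commutator cannot be applied to \<open>f\<close>.  It is
replaced by the Weyl relation of the unitary groups that \<open>D\<^sub>x\<close> and \<open>D\<^sub>y\<close> generate: the magnetic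
translations \<open>T\<^sub>v f(z) = f(z + v) exp(2\<pi>\<i> Im(v z\<^sup>*))\<close>, where \<open>z\<^sup>*\<close> is the conjugate, satisfy
\<open>\<langle>T\<^sub>v f, T\<^sub>w f\<rangle> = exp(-2\<pi>\<i> Im(v w\<^sup>*)) \<langle>T\<^sub>v\<^sub>-\<^sub>w f, f\<rangle>\<close> (\<open>mag_translate_inner\<close>).  The two inner
products of \<open>T\<^sub>\<i>\<^sub>s f\<close> with \<open>T\<^sub>-\<^sub>s f\<close> and of \<open>T\<^sub>s f\<close> with \<open>T\<^sub>-\<^sub>\<i>\<^sub>s f\<close> differ by
\<open>2\<i> sin(2\<pi>s\<^sup>2) \<langle>T\<^sub>s\<^sub>+\<^sub>\<i>\<^sub>s f, f\<rangle>\<close>; when they are expanded around \<open>f\<close> their first-order terms agree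
and only products of two increments \<open>T\<^sub>v f - f\<close> are left.  Dividing by \<open>s\<^sup>2\<close> and letting \<open>s\<close> tend
to 0 gives the uncertainty principle (\<open>commutator_estimate\<close>, \<open>uncertainty_principle\<close>), provided
that the increments are of first order:

\<open>\<parallel>T\<^sub>s\<^sub>v f - f\<parallel> \<le> \<bar>s\<bar> \<parallel>D\<^sub>v f\<parallel>\<close> whenever \<open>D\<^sub>v f\<close> is weakly in \<open>L\<^sup>2\<close> (\<open>norm2_mag_translate_diff\<close>).

To see this, pair \<open>T\<^sub>s\<^sub>v f\<close> with a test function \<open>\<phi>\<close> and move the translation to \<open>\<phi>\<close>.  The
definition of the weak derivative shows that the pairing is differentiable in \<open>s\<close>, with a
derivative of modulus at most \<open>\<parallel>D\<^sub>v f\<parallel>\<parallel>\<phi>\<parallel>\<close>.  The mean value inequality then bounds the pairing of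
\<open>T\<^sub>s\<^sub>v f - f\<close> with each test function, which determines its norm because test functions are dense
(\<open>norm2_le_by_test_functions\<close>).\<close>

section \<open>Square integrable functions\<close>

definition square_integrable :: "(complex \<Rightarrow> complex) \<Rightarrow> bool" where
  "square_integrable f \<longleftrightarrow> f \<in> borel_measurable lborel \<and> integrable lborel (\<lambda>z. (cmod (f z))\<^sup>2)"

definition norm2 :: "(complex \<Rightarrow> complex) \<Rightarrow> real" where
  "norm2 f = sqrt (\<integral>z. (cmod (f z))\<^sup>2 \<partial>lborel)"

lemma norm2_nonneg [simp]: "norm2 f \<ge> 0"
  by (simp add: norm2_def)

lemma norm2_power2: "(norm2 f)\<^sup>2 = (\<integral>z. (cmod (f z))\<^sup>2 \<partial>lborel)"
  by (simp add: norm2_def)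

lemma square_integrable_scale:
  assumes "square_integrable f" shows "square_integrable (\<lambda>z. c * f z)"
  using assms unfolding square_integrable_def by (auto simp: norm_mult power_mult_distrib)

lemma square_integrable_add:
  assumes "square_integrable f" "square_integrable g"
  shows "square_integrable (\<lambda>z. f z + g z)"
proof -
  have [measurable]: "f \<in> borel_measurable lborel" "g \<in> borel_measurable lborel"
    using assms by (auto simp: square_integrable_def)
  have "(cmod (f z + g z))\<^sup>2 \<le> 2 * (cmod (f z))\<^sup>2 + 2 * (cmod (g z))\<^sup>2" for z
  proof -
    have "(cmod (f z + g z))\<^sup>2 \<le> (cmod (f z) + cmod (g z))\<^sup>2"
      by (intro power_mono norm_triangle_ineq) auto
    also have "\<dots> \<le> 2 * (cmod (f z))\<^sup>2 + 2 * (cmod (g z))\<^sup>2"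
      using sum_squares_bound[of "cmod (f z)" "cmod (g z)"] by (simp add: power2_sum)
    finally show ?thesis .
  qed
  moreover have "integrable lborel (\<lambda>z. 2 * (cmod (f z))\<^sup>2 + 2 * (cmod (g z))\<^sup>2)"
    using assms by (auto simp: square_integrable_def)
  ultimately have "integrable lborel (\<lambda>z. (cmod (f z + g z))\<^sup>2)"
    by (intro Bochner_Integration.integrable_bound[where g = "\<lambda>z. (cmod (f z + g z))\<^sup>2"
         and f = "\<lambda>z. 2 * (cmod (f z))\<^sup>2 + 2 * (cmod (g z))\<^sup>2"]) auto
  then show ?thesis by (simp add: square_integrable_def)
qed

lemma square_integrable_diff:
  assumes "square_integrable f" "square_integrable g"
  shows "square_integrable (\<lambda>z. f z - g z)"
  using square_integrable_add[OF assms(1) square_integrable_scale[OF assms(2), of "-1"]] by simp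

lemma square_integrable_cnj:
  assumes "square_integrable f" shows "square_integrable (\<lambda>z. cnj (f z))"
  using assms borel_measurable_continuous_on[OF continuous_on_cnj[OF continuous_on_id], of f lborel]
  by (auto simp: square_integrable_def)

lemma norm2_cnj [simp]: "norm2 (\<lambda>z. cnj (f z)) = norm2 f"
  by (simp add: norm2_def)

lemma square_integrable_mult_integrable:
  assumes "square_integrable f" "square_integrable g"
  shows "integrable lborel (\<lambda>z. f z * g z)"
proof -
  have [measurable]: "f \<in> borel_measurable lborel" "g \<in> borel_measurable lborel"
    using assms by (auto simp: square_integrable_def)
  have "cmod (f z) * cmod (g z) \<le> (cmod (f z))\<^sup>2 + (cmod (g z))\<^sup>2" for z
    using sum_squares_bound[of "cmod (f z)" "cmod (g z)"] 
      mult_nonneg_nonneg[of "cmod (f z)" "cmod (g z)"]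
    by (auto simp: mult.assoc intro: order_trans[rotated])
  moreover have "integrable lborel (\<lambda>z. (cmod (f z))\<^sup>2 + (cmod (g z))\<^sup>2)"
    using assms by (auto simp: square_integrable_def)
  ultimately show ?thesis
    by (intro Bochner_Integration.integrable_bound[where g = "\<lambda>z. f z * g z"
         and f = "\<lambda>z. (cmod (f z))\<^sup>2 + (cmod (g z))\<^sup>2"]) (auto simp: norm_mult)
qed

lemma Cauchy_Schwarz_norm2:
  assumes "square_integrable f" "square_integrable g"
  shows "cmod (\<integral>z. f z * g z \<partial>lborel) \<le> norm2 f * norm2 g"
proof -
  have [measurable]: "f \<in> borel_measurable lborel" "g \<in> borel_measurable lborel"
    and i: "integrable lborel (\<lambda>z. (cmod (f z))\<^sup>2)" "integrable lborel (\<lambda>z. (cmod (g z))\<^sup>2)"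
    using assms by (auto simp: square_integrable_def)
  have ifg: "integrable lborel (\<lambda>z. cmod (f z) * cmod (g z))"
    using integrable_norm[OF square_integrable_mult_integrable[OF assms]] by (simp add: norm_mult)
  define J where "J = (\<integral>z. cmod (f z) * cmod (g z) \<partial>lborel)"
  have J0: "J \<ge> 0" unfolding J_def by (intro integral_nonneg_AE) auto
  have "ennreal (J\<^sup>2) = (\<integral>\<^sup>+z. ennreal (cmod (f z)) * ennreal (cmod (g z)) \<partial>lborel)\<^sup>2"
    using nn_integral_eq_integral[OF ifg] J0
    by (simp add: J_def ennreal_mult ennreal_power[symmetric])
  also have "\<dots> \<le> (\<integral>\<^sup>+z. (ennreal (cmod (f z)))\<^sup>2 \<partial>lborel) * (\<integral>\<^sup>+z. (ennreal (cmod (g z)))\<^sup>2 \<partial>lborel)"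
    by (rule Cauchy_Schwarz_nn_integral) auto
  also have "\<dots> = ennreal ((norm2 f)\<^sup>2 * (norm2 g)\<^sup>2)"
    using nn_integral_eq_integral[OF i(1)] nn_integral_eq_integral[OF i(2)]
    by (simp add: ennreal_power norm2_power2 ennreal_mult)
  finally have "J\<^sup>2 \<le> (norm2 f * norm2 g)\<^sup>2"
    by (simp add: power_mult_distrib)
  then have "J \<le> norm2 f * norm2 g"
    by (rule power2_le_imp_le) auto
  moreover have "cmod (\<integral>z. f z * g z \<partial>lborel) \<le> J"
    unfolding J_def using integral_norm_bound[of lborel "\<lambda>z. f z * g z"] by (simp add: norm_mult)
  ultimately show ?thesis by simp
qed

lemma integral_norm_square:
  "(\<integral>z. f z * cnj (f z) \<partial>lborel) = of_real ((norm2 f)\<^sup>2)"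
proof -
  have "(\<integral>z. f z * cnj (f z) \<partial>lborel) = (\<integral>z. of_real ((cmod (f z))\<^sup>2) \<partial>lborel)"
    by (simp only: complex_norm_square)
  then show ?thesis by (simp only: norm2_power2 integral_complex_of_real)
qed

section \<open>Smooth functions of two real variables\<close>

lemma partials_eq:
  assumes "(\<phi> has_derivative (\<lambda>h. of_real (Re h) * a + of_real (Im h) * b)) (at z)"
  shows "partial_x \<phi> z = a" "partial_y \<phi> z = b"
  using frechet_derivative_at[OF assms]
  by (auto simp: partial_x_def partial_y_def dest: fun_cong[of _ _ 1] fun_cong[of _ _ \<i>])

lemma has_derivative_partials:
  assumes "\<phi> differentiable (at z)"
  shows "(\<phi> has_derivative (\<lambda>h. of_real (Re h) * partial_x \<phi> z + of_real (Im h) * partial_y \<phi> z)) (at z)"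
proof -
  let ?D = "frechet_derivative \<phi> (at z)"
  have D: "(\<phi> has_derivative ?D) (at z)"
    using assms by (simp add: frechet_derivative_works)
  then have lin: "linear ?D" by (rule has_derivative_linear)
  have "?D h = of_real (Re h) * partial_x \<phi> z + of_real (Im h) * partial_y \<phi> z" for h
  proof -
    have "?D h = ?D (Re h *\<^sub>R 1 + Im h *\<^sub>R \<i>)"
      by (rule arg_cong[of _ _ ?D]) (simp add: complex_eq_iff)
    also have "\<dots> = Re h *\<^sub>R ?D 1 + Im h *\<^sub>R ?D \<i>"
      by (simp only: linear_add[OF lin] linear_scale[OF lin])
    finally show ?thesis
      by (simp only: partial_x_def partial_y_def scaleR_conv_of_real)
  qed
  then have "?D = (\<lambda>h. of_real (Re h) * partial_x \<phi> z + of_real (Im h) * partial_y \<phi> z)" by auto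
  with D show ?thesis by simp
qed

text \<open>A candidate for the gradient that is itself of class \<open>k\<close> suffices: the partial derivatives
are then forced to be its components.  Through this rule the closure of \<open>Ck\<close> under sums,
products and translations follows by induction on \<open>k\<close>.\<close>

lemma Ck_SucI:
  assumes "\<And>z. (\<phi> has_derivative (\<lambda>h. of_real (Re h) * a z + of_real (Im h) * b z)) (at z)"
    and "Ck k a" "Ck k b"
  shows "Ck (Suc k) \<phi>"
proof -
  have "partial_x \<phi> = a" "partial_y \<phi> = b"
    using partials_eq[OF assms(1)] by auto
  then show ?thesis using assms by (auto simp: differentiable_def)
qed

lemma Ck_Suc_imp: "Ck (Suc k) \<phi> \<Longrightarrow> Ck k \<phi>"
proof (induction k arbitrary: \<phi>)
  case 0
  then show ?case
    by (auto intro!: continuous_at_imp_continuous_on differentiable_imp_continuous_within)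
next
  case (Suc k)
  have *: "Ck (Suc k) (partial_x \<phi>)" "Ck (Suc k) (partial_y \<phi>)" "\<forall>z. \<phi> differentiable (at z)"
    using Suc.prems unfolding Ck.simps(2)[of "Suc k"] by blast+
  show ?case
    by (subst Ck.simps(2)) (intro conjI Suc.IH *)
qed

lemma Ck_const: "Ck k (\<lambda>z. c)"
proof (induction k arbitrary: c)
  case (Suc k)
  show ?case by (rule Ck_SucI[where a = "\<lambda>z. 0" and b = "\<lambda>z. 0"]) (simp_all add: Suc)
qed simp

lemma Ck_add: "Ck k f \<Longrightarrow> Ck k g \<Longrightarrow> Ck k (\<lambda>z. f z + g z)"
proof (induction k arbitrary: f g)
  case 0 then show ?case by (auto intro!: continuous_intros)
next
  case (Suc k)
  show ?case
  proof (rule Ck_SucI)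
    show "((\<lambda>z. f z + g z) has_derivative (\<lambda>h. of_real (Re h) * (partial_x f z + partial_x g z)
        + of_real (Im h) * (partial_y f z + partial_y g z))) (at z)" for z
      by (rule has_derivative_eq_rhs[OF has_derivative_add[OF has_derivative_partials has_derivative_partials]])
         (use Suc.prems in \<open>simp_all add: algebra_simps\<close>)
    show "Ck k (\<lambda>z. partial_x f z + partial_x g z)" "Ck k (\<lambda>z. partial_y f z + partial_y g z)"
      by (rule Suc.IH; use Suc.prems in simp)+
  qed
qed

lemma Ck_mult: "Ck k f \<Longrightarrow> Ck k g \<Longrightarrow> Ck k (\<lambda>z. f z * g z)"
proof (induction k arbitrary: f g)
  case 0 then show ?case by (auto intro!: continuous_intros)
next
  case (Suc k)
  show ?case
  proof (rule Ck_SucI)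
    show "((\<lambda>z. f z * g z) has_derivative (\<lambda>h. of_real (Re h) * (partial_x f z * g z + f z * partial_x g z)
        + of_real (Im h) * (partial_y f z * g z + f z * partial_y g z))) (at z)" for z
      by (rule has_derivative_eq_rhs[OF has_derivative_mult[OF has_derivative_partials has_derivative_partials]])
         (use Suc.prems in \<open>simp_all add: algebra_simps\<close>)
    have f: "Ck k f" "Ck k (partial_x f)" "Ck k (partial_y f)"
      and g: "Ck k g" "Ck k (partial_x g)" "Ck k (partial_y g)"
      using Suc.prems Ck_Suc_imp[OF Suc.prems(1)] Ck_Suc_imp[OF Suc.prems(2)] by simp_all
    show "Ck k (\<lambda>z. partial_x f z * g z + f z * partial_x g z)"
      by (rule Ck_add[OF Suc.IH[OF f(2) g(1)] Suc.IH[OF f(1) g(2)]])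
    show "Ck k (\<lambda>z. partial_y f z * g z + f z * partial_y g z)"
      by (rule Ck_add[OF Suc.IH[OF f(3) g(1)] Suc.IH[OF f(1) g(3)]])
  qed
qed

lemma Ck_translate: "Ck k f \<Longrightarrow> Ck k (\<lambda>z. f (z + v))"
proof (induction k arbitrary: f)
  case 0
  have "continuous_on UNIV (\<lambda>z. z + v)" by (intro continuous_intros)
  with 0 show ?case using continuous_on_compose2[of UNIV f UNIV "\<lambda>z. z + v"] by simp
next
  case (Suc k)
  show ?case
  proof (rule Ck_SucI)
    show "((\<lambda>z. f (z + v)) has_derivative (\<lambda>h. of_real (Re h) * partial_x f (z + v)
        + of_real (Im h) * partial_y f (z + v))) (at z)" for z
      by (rule has_derivative_compose[of "\<lambda>z. z + v" "\<lambda>h. h", OF _ has_derivative_partials])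
         (use Suc.prems in \<open>auto intro!: derivative_eq_intros\<close>)
    show "Ck k (\<lambda>z. partial_x f (z + v))" "Ck k (\<lambda>z. partial_y f (z + v))"
      by (rule Suc.IH; use Suc.prems in simp)+
  qed
qed

text \<open>The sequence \<open>g\<close> lists the successive derivatives of \<open>g 0\<close>, so the induction needs no
higher derivative operator.  Phases, linear functions and cut-off profiles are all instances.\<close>

lemma Ck_compose_affine:
  fixes g :: "nat \<Rightarrow> real \<Rightarrow> complex"
  assumes "\<And>n t. (g n has_vector_derivative g (Suc n) t) (at t)"
  shows "Ck k (\<lambda>z. g n (a * Re z + b * Im z + c))"
proof (induction k arbitrary: n)
  case 0
  have "continuous_on UNIV (g n)" 
    by (intro continuous_at_imp_continuous_on ballI has_vector_derivative_continuous[OF assms])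
  moreover have "continuous_on UNIV (\<lambda>z. a * Re z + b * Im z + c)" by (intro continuous_intros)
  ultimately show ?case
    using continuous_on_compose2[of UNIV "g n" UNIV "\<lambda>z. a * Re z + b * Im z + c"] by simp
next
  case (Suc k)
  show ?case
  proof (rule Ck_SucI)
    fix z
    have lin: "((\<lambda>z. a * Re z + b * Im z + c) has_derivative (\<lambda>h. a * Re h + b * Im h)) (at z)"
      by (auto intro!: derivative_eq_intros)
    have "((\<lambda>z. g n (a * Re z + b * Im z + c)) has_derivative
        (\<lambda>h. (a * Re h + b * Im h) *\<^sub>R g (Suc n) (a * Re z + b * Im z + c))) (at z)"
      using has_derivative_compose[OF lin assms[unfolded has_vector_derivative_def]] .
    then show "((\<lambda>z. g n (a * Re z + b * Im z + c)) has_derivative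
        (\<lambda>h. of_real (Re h) * (of_real a * g (Suc n) (a * Re z + b * Im z + c))
           + of_real (Im h) * (of_real b * g (Suc n) (a * Re z + b * Im z + c)))) (at z)"
      by (simp add: scaleR_conv_of_real algebra_simps)
    show "Ck k (\<lambda>z. of_real a * g (Suc n) (a * Re z + b * Im z + c))"
      "Ck k (\<lambda>z. of_real b * g (Suc n) (a * Re z + b * Im z + c))"
      by (rule Ck_mult[OF Ck_const Suc])+
  qed
qed

lemma Ck_real_polynomial:
  assumes "real_polynomial_function q"
  shows "Ck k (\<lambda>z. of_real (q z))"
  using assms
proof (induction q rule: real_polynomial_function.induct)
  case (linear q)
  then interpret bounded_linear q .
  let ?g = "\<lambda>n t. if n = 0 then complex_of_real t else if n = Suc 0 then 1 else 0"
  have "(?g n has_vector_derivative ?g (Suc n) t) (at t)" for n t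
  proof -
    have "((\<lambda>t. complex_of_real t) has_vector_derivative of_real 1) (at t)"
      by (rule has_vector_derivative_of_real[OF DERIV_ident])
    then show ?thesis by (cases n) auto
  qed
  from Ck_compose_affine[of ?g, OF this, where n = 0 and k = k and a = "q 1" and b = "q \<i>" and c = 0]
  \<comment> \<open>A linear function is the affine function whose slopes are its values at 1 and \<open>\<i>\<close>.\<close>
  have lin: "Ck k (\<lambda>z. of_real (q 1 * Re z + q \<i> * Im z))" by simp
  have "q z = q 1 * Re z + q \<i> * Im z" for z
  proof -
    have "z = Re z *\<^sub>R 1 + Im z *\<^sub>R \<i>" by (simp add: complex_eq_iff)
    then have "q z = q (Re z *\<^sub>R 1 + Im z *\<^sub>R \<i>)" by (rule arg_cong)
    also have "\<dots> = Re z *\<^sub>R q 1 + Im z *\<^sub>R q \<i>" by (simp only: add scaleR)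
    finally show ?thesis by (simp add: mult.commute)
  qed
  then have "(\<lambda>z. complex_of_real (q z)) = (\<lambda>z. of_real (q 1 * Re z + q \<i> * Im z))"
    by (intro ext arg_cong[of _ _ of_real])
  then show ?case by (rule ssubst[where P = "Ck k"]) (rule lin)
next
  case (const c)
  show ?case by (rule Ck_const)
next
  case (add f g)
  then show ?case using Ck_add[of k "\<lambda>z. of_real (f z)" "\<lambda>z. of_real (g z)"] by simp
next
  case (mult f g)
  then show ?case using Ck_mult[of k "\<lambda>z. of_real (f z)" "\<lambda>z. of_real (g z)"] by simp
qed

lemma Ck_polynomial:
  assumes "polynomial_function p"
  shows "Ck k p"
proof -
  have "real_polynomial_function (\<lambda>z. Re (p z))" "real_polynomial_function (\<lambda>z. Im (p z))"
    using assms bounded_linear_Re bounded_linear_Im by (auto simp: polynomial_function_def o_def)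
  then have "Ck k (\<lambda>z. of_real (Re (p z)) + \<i> * of_real (Im (p z)))"
    by (rule Ck_add[OF Ck_real_polynomial Ck_mult[OF Ck_const Ck_real_polynomial]])
  moreover have "(\<lambda>z. of_real (Re (p z)) + \<i> * of_real (Im (p z))) = p"
    by (simp add: fun_eq_iff complex_eq_iff)
  ultimately show ?thesis by simp
qed

section \<open>Test functions\<close>

lemma test_function_iff:
  "test_function \<phi> \<longleftrightarrow> (\<forall>k. Ck k \<phi>) \<and> (\<exists>R. \<forall>z. R < cmod z \<longrightarrow> \<phi> z = 0)"
proof -
  have "compact (closure {z. \<phi> z \<noteq> 0}) \<longleftrightarrow> (\<exists>R. \<forall>z. R < cmod z \<longrightarrow> \<phi> z = 0)"
    unfolding compact_closure bounded_iff mem_Collect_eq Ball_def by (meson not_le)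
  then show ?thesis by (simp add: test_function_def)
qed

lemma test_functionI:
  assumes "\<And>k. Ck k \<phi>" "\<And>z. R < cmod z \<Longrightarrow> \<phi> z = 0"
  shows "test_function \<phi>"
  using assms unfolding test_function_iff by auto

lemma test_function_smooth: "test_function \<phi> \<Longrightarrow> Ck k \<phi>"
  by (simp add: test_function_def)

lemma test_function_support:
  assumes "test_function \<phi>"
  obtains R where "R > 0" "\<And>z. R < cmod z \<Longrightarrow> \<phi> z = 0"
proof -
  obtain R where "\<And>z. R < cmod z \<Longrightarrow> \<phi> z = 0"
    using assms by (auto simp: test_function_iff)
  then show thesis by (intro that[of "max R 1"]) auto
qed

lemma test_function_mult:
  assumes "\<And>k. Ck k a" "test_function \<phi>"
  shows "test_function (\<lambda>z. a z * \<phi> z)"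
proof -
  obtain R where "\<And>z. R < cmod z \<Longrightarrow> \<phi> z = 0"
    using assms(2) by (meson test_function_support)
  then show ?thesis
    by (intro test_functionI[where R = R] Ck_mult assms(1) test_function_smooth[OF assms(2)]) simp
qed

lemma test_function_add:
  assumes "test_function \<phi>" "test_function \<psi>"
  shows "test_function (\<lambda>z. \<phi> z + \<psi> z)"
proof -
  obtain R S where "\<And>z. R < cmod z \<Longrightarrow> \<phi> z = 0" "\<And>z. S < cmod z \<Longrightarrow> \<psi> z = 0"
    using assms by (meson test_function_support)
  then show ?thesis
    by (intro test_functionI[where R = "max R S"] Ck_add assms[THEN test_function_smooth]) simp
qed

lemma test_function_translate:
  assumes "test_function \<phi>"
  shows "test_function (\<lambda>z. \<phi> (z + v))"
proof -
  obtain R where R: "\<And>z. R < cmod z \<Longrightarrow> \<phi> z = 0"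
    using assms by (meson test_function_support)
  have "\<phi> (z + v) = 0" if "R + cmod v < cmod z" for z
    using that norm_triangle_ineq4[of "z + v" v] by (intro R) simp
  then show ?thesis
    by (rule test_functionI[OF Ck_translate[OF test_function_smooth[OF assms]]])
qed

lemma test_function_partials:
  assumes "test_function \<phi>"
  shows "test_function (partial_x \<phi>)" "test_function (partial_y \<phi>)"
proof -
  obtain R where R: "\<And>z. R < cmod z \<Longrightarrow> \<phi> z = 0"
    using assms by (meson test_function_support)
  have "partial_x \<phi> z = 0 \<and> partial_y \<phi> z = 0" if "R < cmod z" for z
  proof -
    have op: "open {z. R < cmod z}" by (intro open_Collect_less continuous_intros)
    have "(\<phi> has_derivative (\<lambda>h. 0)) (at z)"
      by (rule has_derivative_transform_within_open[OF has_derivative_const op]) (use that R in auto)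
    then have "(\<phi> has_derivative (\<lambda>h. of_real (Re h) * 0 + of_real (Im h) * 0)) (at z)"
      by simp
    from partials_eq[OF this] show ?thesis by simp
  qed
  moreover have "Ck k (partial_x \<phi>)" "Ck k (partial_y \<phi>)" for k
    using test_function_smooth[OF assms, of "Suc k"] by auto
  ultimately show "test_function (partial_x \<phi>)" "test_function (partial_y \<phi>)"
    by (meson test_functionI)+
qed

lemma test_function_measurable:
  assumes "test_function \<phi>" shows "\<phi> \<in> borel_measurable lborel"
  using test_function_smooth[OF assms, of 0] by (simp add: borel_measurable_continuous_onI)

lemma test_function_bounded:
  assumes "test_function \<phi>"
  obtains M where "M > 0" "\<And>z. cmod (\<phi> z) \<le> M"
proof -
  obtain R where R: "\<And>z. R < cmod z \<Longrightarrow> \<phi> z = 0"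
    using assms by (meson test_function_support)
  have "continuous_on (cball 0 R) \<phi>"
    using test_function_smooth[OF assms, of 0] continuous_on_subset by auto
  then have "bounded (\<phi> ` cball 0 R)"
    by (intro compact_imp_bounded compact_continuous_image) auto
  then obtain M where M: "M > 0" "\<And>z. z \<in> cball 0 R \<Longrightarrow> cmod (\<phi> z) \<le> M"
    by (auto simp: bounded_pos)
  have "cmod (\<phi> z) \<le> M" for z
    using M(1) M(2)[of z] R[of z] by (cases "R < cmod z") auto
  with M(1) show thesis by (rule that)
qed

lemma square_integrable_bounded_support:
  assumes "\<phi> \<in> borel_measurable lborel" "\<And>z. cmod (\<phi> z) \<le> M" "\<And>z. R < cmod z \<Longrightarrow> \<phi> z = 0"
  shows "square_integrable \<phi>"
proof -
  have "integrable lborel (\<lambda>z. indicator (cball (0::complex) R) z * M\<^sup>2)"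
    using emeasure_compact_finite[of "cball (0::complex) R"]
    by (intro integrable_mult_left integrable_real_indicator) auto
  then have "integrable lborel (\<lambda>z. (cmod (\<phi> z))\<^sup>2)"
  proof (rule Bochner_Integration.integrable_bound)
    have "(cmod (\<phi> z))\<^sup>2 \<le> indicator (cball (0::complex) R) z * M\<^sup>2" for z
      using assms(2)[of z] assms(3)[of z] by (cases "R < cmod z") (auto simp: power_mono)
    then show "AE z in lborel. norm ((cmod (\<phi> z))\<^sup>2) \<le> norm (indicator (cball (0::complex) R) z * M\<^sup>2)"
      by (intro AE_I2) simp
  qed (use assms(1) in measurable)
  with assms show ?thesis by (simp add: square_integrable_def)
qed

lemma test_function_square_integrable:
  assumes "test_function \<phi>" shows "square_integrable \<phi>"
proof -
  obtain M R where "\<And>z. cmod (\<phi> z) \<le> M" "\<And>z. R < cmod z \<Longrightarrow> \<phi> z = 0"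
    using test_function_bounded[OF assms] test_function_support[OF assms] by metis
  then show ?thesis by (rule square_integrable_bounded_support[OF test_function_measurable[OF assms]])
qed

section \<open>Smooth cut-off functions of squares\<close>

text \<open>For \<open>p = 1\<close> this is the classical smooth function \<open>exp(-1/t)\<close> that is flat at 0.  The
polynomial factor in \<open>1/t\<close> makes the family closed under differentiation.\<close>

definition flat :: "real poly \<Rightarrow> real \<Rightarrow> real" where
  "flat p t = (if t > 0 then poly p (1 / t) * exp (- (1 / t)) else 0)"

text \<open>The chain rule turns \<open>p(1/t) exp(-1/t)\<close> into \<open>t\<^sup>-\<^sup>2 (p - p')(1/t) exp(-1/t)\<close>.\<close>

definition flat_next :: "real poly \<Rightarrow> real poly" where
  "flat_next p = [:0, 0, 1:] * (p - pderiv p)"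

lemma poly_over_exp_tendsto_0: "((\<lambda>x. poly p x / exp x) \<longlongrightarrow> (0::real)) at_top"
proof -
  have "((\<lambda>x. \<Sum>i\<le>degree p. coeff p i * (x ^ i / exp x)) \<longlongrightarrow> (\<Sum>i\<le>degree p. coeff p i * 0)) at_top"
    by (intro tendsto_intros tendsto_power_div_exp_0)
  then show ?thesis by (simp add: poly_altdef sum_divide_distrib)
qed

text \<open>Away from 0 this is the chain rule.  At 0 the right difference quotient tends to 0 because,
in the variable \<open>x = 1/t\<close>, an exponential beats every polynomial.\<close>

lemma flat_has_derivative: "(flat p has_real_derivative flat (flat_next p) t) (at t)"
proof -
  consider "t > 0" | "t < 0" | "t = 0" by linarith
  then show ?thesis
  proof cases
    case 1
    have "((\<lambda>t. poly p (1 / t) * exp (- (1 / t))) has_real_derivative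
        poly p (1 / t) * (exp (- (1 / t)) * (1 / t\<^sup>2)) + (poly (pderiv p) (1 / t) * (- (1 / t\<^sup>2))) * exp (- (1 / t))) (at t)"
      using 1 by (auto intro!: derivative_eq_intros DERIV_chain2[OF poly_DERIV] simp: power2_eq_square)
    also have "poly p (1 / t) * (exp (- (1 / t)) * (1 / t\<^sup>2)) + (poly (pderiv p) (1 / t) * (- (1 / t\<^sup>2))) * exp (- (1 / t))
        = flat (flat_next p) t"
      using 1 by (simp add: flat_def flat_next_def field_simps power2_eq_square)
    finally show ?thesis
      by (rule has_field_derivative_transform_within_open[where S = "{0<..}"])
         (use 1 in \<open>auto simp: flat_def\<close>)
  next
    case 2
    have "((\<lambda>t. 0) has_real_derivative 0) (at t)" by simp
    then have "(flat p has_real_derivative 0) (at t)"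
      by (rule has_field_derivative_transform_within_open[where S = "{..<0}"])
         (use 2 in \<open>auto simp: flat_def\<close>)
    then show ?thesis using 2 by (simp add: flat_def)
  next
    case 3
    have "((\<lambda>h. flat p (inverse h) / inverse h) \<longlongrightarrow> 0) at_top"
    proof (rule Lim_transform_eventually[OF poly_over_exp_tendsto_0[of "pCons 0 p"]])
      show "\<forall>\<^sub>F x in at_top. poly (pCons 0 p) x / exp x = flat p (inverse x) / inverse x"
        using eventually_gt_at_top[of 0]
        by eventually_elim (simp add: flat_def exp_minus field_simps)
    qed
    then have "((\<lambda>h. flat p h / h) \<longlongrightarrow> 0) (at_right 0)"
      by (simp add: filterlim_at_right_to_top)
    moreover have "((\<lambda>h. flat p h / h) \<longlongrightarrow> 0) (at_left 0)"
      by (rule Lim_transform_eventually[OF tendsto_const])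
         (auto simp: eventually_at_filter flat_def intro!: always_eventually)
    ultimately have "((\<lambda>h. flat p h / h) \<longlongrightarrow> 0) (at 0)"
      by (simp add: filterlim_split_at)
    then show ?thesis using 3 by (simp add: DERIV_def flat_def)
  qed
qed

lemma Ck_flat: "Ck k (\<lambda>z. of_real (flat 1 (a * Re z + b * Im z + c)))"
proof -
  let ?g = "\<lambda>n t. complex_of_real (flat ((flat_next ^^ n) 1) t)"
  have "(?g n has_vector_derivative ?g (Suc n) t) (at t)" for n t
    using has_vector_derivative_of_real[OF flat_has_derivative[of "(flat_next ^^ n) 1" t]] by simp
  from Ck_compose_affine[of ?g, OF this, of k 0] show ?thesis by simp
qed

text \<open>Stretching the profile \<open>exp(-1/t)\<close> by \<open>n\<close> makes it tend to the indicator of \<open>t > 0\<close>; the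
product over the four sides tends to the indicator of the open square.\<close>

definition bump :: "real \<Rightarrow> nat \<Rightarrow> complex \<Rightarrow> complex" where
  "bump R n z = of_real (flat 1 (real n * (R + Re z))) * of_real (flat 1 (real n * (R - Re z)))
     * (of_real (flat 1 (real n * (R + Im z))) * of_real (flat 1 (real n * (R - Im z))))"

definition square :: "real \<Rightarrow> complex set" where
  "square R = {z. \<bar>Re z\<bar> < R \<and> \<bar>Im z\<bar> < R}"

lemma flat_1_le: "0 \<le> flat 1 t" "flat 1 t \<le> 1" "t \<le> 0 \<Longrightarrow> flat 1 t = 0"
  by (auto simp: flat_def)

lemma bump_le_1: "cmod (bump R n z) \<le> 1"
  unfolding bump_def norm_mult norm_of_real
  by (intro mult_le_one mult_nonneg_nonneg) (simp_all add: flat_1_le)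

lemma bump_outside: "z \<notin> square R \<Longrightarrow> bump R n z = 0"
proof -
  assume "z \<notin> square R"
  then consider "R + Re z \<le> 0" | "R - Re z \<le> 0" | "R + Im z \<le> 0" | "R - Im z \<le> 0"
    by (auto simp: square_def abs_less_iff)
  then show ?thesis
    by cases (auto simp: bump_def flat_1_le(3) mult_nonneg_nonpos)
qed

lemma square_norm: "z \<in> square R \<Longrightarrow> cmod z \<le> 2 * R"
  using cmod_le[of z] by (simp add: square_def)

lemma test_function_bump: "test_function (bump R n)"
proof -
  have "Ck k (bump R n)" for k
  proof -
    have "Ck k (\<lambda>z. of_real (flat 1 (real n * Re z + 0 * Im z + real n * R))
          * of_real (flat 1 ((- real n) * Re z + 0 * Im z + real n * R))
     * (of_real (flat 1 (0 * Re z + real n * Im z + real n * R)) 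
       * of_real (flat 1 (0 * Re z + (- real n) * Im z + real n * R))))"
      by (intro Ck_mult Ck_flat)
    then show ?thesis by (simp add: bump_def[abs_def] algebra_simps)
  qed
  moreover have "bump R n z = 0" if "2 * R < cmod z" for z
    using square_norm[of z R] that by (intro bump_outside) auto
  ultimately show ?thesis by (rule test_functionI)
qed

lemma flat_tendsto: "(\<lambda>n. flat 1 (real n * t)) \<longlonglongrightarrow> (if t > 0 then 1 else 0)"
proof (cases "t > 0")
  case True
  have "(\<lambda>n. exp (- (1 / t * inverse (real n)))) \<longlonglongrightarrow> exp (- (1 / t * 0))"
    by (intro tendsto_intros lim_inverse_n)
  moreover have "\<forall>\<^sub>F n in sequentially. exp (- (1 / t * inverse (real n))) = flat 1 (real n * t)"
    using eventually_gt_at_top[of 0] by eventually_elim (use True in \<open>simp add: flat_def field_simps\<close>)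
  ultimately show ?thesis using True by (auto intro: Lim_transform_eventually)
next
  case False
  then have "flat 1 (real n * t) = 0" for n by (intro flat_1_le) (simp add: mult_nonneg_nonpos)
  with False show ?thesis by simp
qed

lemma bump_tendsto: "(\<lambda>n. bump R n z) \<longlonglongrightarrow> (if z \<in> square R then 1 else 0)"
proof (cases "z \<in> square R")
  case True
  then have "R + Re z > 0" "R - Re z > 0" "R + Im z > 0" "R - Im z > 0"
    by (auto simp: square_def abs_less_iff)
  then have "(\<lambda>n. flat 1 (real n * t)) \<longlonglongrightarrow> 1" if "t \<in> {R + Re z, R - Re z, R + Im z, R - Im z}" for t
    using flat_tendsto[of t] that by auto
  then have "(\<lambda>n. bump R n z) \<longlonglongrightarrow> of_real 1 * of_real 1 * (of_real 1 * of_real 1)"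
    unfolding bump_def by (intro tendsto_mult tendsto_of_real) simp_all
  with True show ?thesis by simp
qed (simp add: bump_outside)

section \<open>Testing the norm against test functions\<close>

text \<open>A bound for the pairing with \<open>w\<close> that is known on test functions has to be extended to \<open>cnj w\<close>.
It is carried along a chain of dominated limits, so the bound is recorded for one function \<open>u\<close> at
a time.\<close>

definition paired_below :: "(complex \<Rightarrow> complex) \<Rightarrow> real \<Rightarrow> (complex \<Rightarrow> complex) \<Rightarrow> bool" where
  "paired_below w C u \<longleftrightarrow> square_integrable u \<and> cmod (\<integral>z. w z * u z \<partial>lborel) \<le> C * norm2 u"

text \<open>Both sides of the defining inequality converge by dominated convergence: the squares under
\<open>\<bar>d\<bar>\<^sup>2\<close>, the pairing under \<open>\<bar>w d\<bar>\<close>.\<close>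

lemma paired_below_limit:
  assumes w: "square_integrable w" and u: "\<And>n. paired_below w C (u n)"
    and d: "square_integrable d" "\<And>n z. cmod (u n z) \<le> cmod (d z)"
    and lim: "AE z in lborel. (\<lambda>n. u n z) \<longlonglongrightarrow> v z" and v: "v \<in> borel_measurable lborel"
  shows "paired_below w C v"
proof -
  have [measurable]: "w \<in> borel_measurable lborel" "d \<in> borel_measurable lborel" "u n \<in> borel_measurable lborel" for n
    using w d u by (auto simp: square_integrable_def paired_below_def)
  note v [measurable]
  have id: "integrable lborel (\<lambda>z. (cmod (d z))\<^sup>2)" using d by (simp add: square_integrable_def)
  have sq_lim: "AE z in lborel. (\<lambda>n. (cmod (u n z))\<^sup>2) \<longlonglongrightarrow> (cmod (v z))\<^sup>2"
    using lim by eventually_elim (intro tendsto_intros)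
  have sq_bd: "AE z in lborel. norm ((cmod (u n z))\<^sup>2) \<le> (cmod (d z))\<^sup>2" for n
    using d(2)[of n] by (intro AE_I2) (simp add: power_mono)
  have iv: "integrable lborel (\<lambda>z. (cmod (v z))\<^sup>2)"
    by (rule integrable_dominated_convergence[OF _ _ id sq_lim sq_bd]) measurable
  have "(\<lambda>n. \<integral>z. (cmod (u n z))\<^sup>2 \<partial>lborel) \<longlonglongrightarrow> (\<integral>z. (cmod (v z))\<^sup>2 \<partial>lborel)"
    by (rule integral_dominated_convergence[OF _ _ id sq_lim sq_bd]) measurable
  then have "(\<lambda>n. C * norm2 (u n)) \<longlonglongrightarrow> C * norm2 v"
    unfolding norm2_def by (intro tendsto_intros)
  moreover have "(\<lambda>n. \<integral>z. w z * u n z \<partial>lborel) \<longlonglongrightarrow> (\<integral>z. w z * v z \<partial>lborel)"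
  proof (rule integral_dominated_convergence)
    show "integrable lborel (\<lambda>z. cmod (w z * d z))"
      by (intro integrable_norm square_integrable_mult_integrable w d)
    show "AE z in lborel. (\<lambda>n. w z * u n z) \<longlonglongrightarrow> w z * v z"
      using lim by eventually_elim (intro tendsto_intros)
    show "AE z in lborel. norm (w z * u n z) \<le> cmod (w z * d z)" for n
      using d(2)[of n] by (intro AE_I2) (simp add: norm_mult mult_left_mono)
  qed measurable
  then have "(\<lambda>n. cmod (\<integral>z. w z * u n z \<partial>lborel)) \<longlonglongrightarrow> cmod (\<integral>z. w z * v z \<partial>lborel)"
    by (rule tendsto_norm)
  ultimately have "cmod (\<integral>z. w z * v z \<partial>lborel) \<le> C * norm2 v"
    using u by (intro LIMSEQ_le[where X = "\<lambda>n. cmod (\<integral>z. w z * u n z \<partial>lborel)" and Y = "\<lambda>n. C * norm2 (u n)"])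
      (auto simp: paired_below_def)
  with iv v show ?thesis by (simp add: paired_below_def square_integrable_def)
qed

lemma square_borel [measurable]: "square R \<in> sets borel"
proof -
  have "square R = {z. \<bar>Re z\<bar> < R} \<inter> {z. \<bar>Im z\<bar> < R}" by (auto simp: square_def)
  also have "open \<dots>" by (intro open_Int open_Collect_less continuous_intros)
  finally show ?thesis by simp
qed

lemma square_integrable_square:
  assumes "g \<in> borel_measurable lborel" "\<And>z. z \<in> square R \<Longrightarrow> cmod (g z) \<le> M"
  shows "square_integrable (\<lambda>z. if z \<in> square R then g z else 0)"
proof (rule square_integrable_bounded_support)
  show "(\<lambda>z. if z \<in> square R then g z else 0) \<in> borel_measurable lborel"
    using assms(1) by measurable
  show "cmod (if z \<in> square R then g z else 0) \<le> max 0 M" for z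
    using assms(2)[of z] by auto
  show "(if z \<in> square R then g z else 0) = 0" if "2 * R < cmod z" for z
    using square_norm[of z R] that by auto
qed

text \<open>A polynomial times a cut-off is a test function.  By Stone--Weierstrass such products
converge to \<open>g\<close> on the square, and they are dominated by a constant on it.\<close>

lemma paired_below_continuous:
  assumes w: "square_integrable w" and test: "\<And>\<phi>. test_function \<phi> \<Longrightarrow> paired_below w C \<phi>"
    and g: "continuous_on UNIV g"
  shows "paired_below w C (\<lambda>z. if z \<in> square R then g z else 0)"
proof -
  have cont: "continuous_on (cball 0 (2 * R)) g"
    using g by (rule continuous_on_subset) simp
  then have "\<exists>p. polynomial_function p \<and> (\<forall>z \<in> cball 0 (2 * R). cmod (g z - p z) < inverse (real (Suc n)))" for n
    by (intro Stone_Weierstrass_polynomial_function compact_cball) simp_all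
  then obtain p where p: "\<And>n. polynomial_function (p n)"
    and pg: "\<And>n z. z \<in> cball 0 (2 * R) \<Longrightarrow> cmod (g z - p n z) < inverse (real (Suc n))"
    by metis
  have sub: "square R \<subseteq> cball 0 (2 * R)" using square_norm by auto
  have "bounded (g ` cball 0 (2 * R))"
    by (intro compact_imp_bounded compact_continuous_image cont compact_cball)
  then obtain M where M: "M > 0" "\<And>z. z \<in> cball 0 (2 * R) \<Longrightarrow> cmod (g z) \<le> M"
    by (auto simp: bounded_pos)
  show ?thesis
  proof (rule paired_below_limit[OF w])
    show "paired_below w C (\<lambda>z. p n z * bump R n z)" for n
      by (intro test test_function_mult test_function_bump Ck_polynomial p)
    show "square_integrable (\<lambda>z. if z \<in> square R then of_real (M + 1) else 0)"
      by (rule square_integrable_square[where M = "M + 1"]) (use M in auto)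
    show "cmod (p n z * bump R n z) \<le> cmod (if z \<in> square R then of_real (M + 1) else 0)" for n z
    proof (cases "z \<in> square R")
      case True
      then have z: "z \<in> cball 0 (2 * R)" using sub by auto
      have "cmod (p n z) \<le> cmod (g z) + cmod (g z - p n z)"
        by (metis norm_minus_commute norm_triangle_sub)
      also have "\<dots> \<le> M + 1"
        using M(2)[OF z] pg[OF z, of n] inverse_le_1_iff[of "real (Suc n)"] by linarith
      finally have "cmod (p n z) * cmod (bump R n z) \<le> (M + 1) * 1"
        using bump_le_1 M(1) by (intro mult_mono) auto
      with True M(1) show ?thesis by (simp add: norm_mult)
    qed (simp add: bump_outside)
    show "AE z in lborel. (\<lambda>n. p n z * bump R n z) \<longlonglongrightarrow> (if z \<in> square R then g z else 0)"
    proof (rule AE_I2)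
      fix z
      show "(\<lambda>n. p n z * bump R n z) \<longlonglongrightarrow> (if z \<in> square R then g z else 0)"
      proof (cases "z \<in> square R")
        case True
        then have z: "z \<in> cball 0 (2 * R)" using sub by auto
        have "(\<lambda>n. p n z - g z) \<longlonglongrightarrow> 0"
          by (rule Lim_null_comparison[OF _ LIMSEQ_inverse_real_of_nat])
             (use pg[OF z] in \<open>auto simp: norm_minus_commute intro!: always_eventually less_imp_le\<close>)
        then have "(\<lambda>n. p n z) \<longlonglongrightarrow> g z" by (simp add: LIM_zero_iff)
        from tendsto_mult[OF this bump_tendsto[of R z]] True show ?thesis by simp
      qed (simp add: bump_outside)
    qed
    show "(\<lambda>z. if z \<in> square R then g z else 0) \<in> borel_measurable lborel"
      using borel_measurable_continuous_onI[OF g] by measurable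
  qed
qed

text \<open>The radial retraction of the plane onto the disc of radius \<open>M\<close>.\<close>

definition clamp_to :: "real \<Rightarrow> complex \<Rightarrow> complex" where
  "clamp_to M x = of_real (M / max M (cmod x)) * x"

lemma clamp_to_continuous: "M > 0 \<Longrightarrow> continuous_on UNIV (clamp_to M)"
  unfolding clamp_to_def by (intro continuous_intros) auto

lemma clamp_to_bounds:
  assumes "M > 0"
  shows "cmod (clamp_to M x) \<le> M" "cmod (clamp_to M x) \<le> cmod x"
    "cmod x \<le> M \<Longrightarrow> clamp_to M x = x"
proof -
  have [simp]: "max M (cmod x) > 0" using assms by simp
  have e: "cmod (clamp_to M x) = M * cmod x / max M (cmod x)"
    using assms by (simp add: clamp_to_def norm_mult norm_divide)
  show "cmod (clamp_to M x) \<le> M"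
    unfolding e using assms by (simp add: pos_divide_le_eq mult_left_mono)
  show "cmod (clamp_to M x) \<le> cmod x"
    unfolding e using mult_left_mono[of M "max M (cmod x)" "cmod x"]
    by (simp add: pos_divide_le_eq mult.commute)
  show "clamp_to M x = x" if "cmod x \<le> M"
    using that assms by (simp add: clamp_to_def max_absorb1)
qed

text \<open>A square integrable function is an almost everywhere limit of continuous functions.  Clamping
these to modulus \<open>M\<close> and restricting to a square makes the limit dominated, so the bound passes from
continuous functions to the clamped \<open>cnj w\<close>, and then, as \<open>M\<close> grows, to \<open>cnj w\<close>.  Pairing \<open>w\<close> with
\<open>cnj w\<close> gives \<open>\<parallel>w\<parallel>\<^sup>2 \<le> C \<parallel>w\<parallel>\<close>.\<close>

lemma norm2_le_by_test_functions:
  assumes w: "square_integrable w" and C: "C \<ge> 0"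
    and test: "\<And>\<phi>. test_function \<phi> \<Longrightarrow> cmod (\<integral>z. w z * \<phi> z \<partial>lborel) \<le> C * norm2 \<phi>"
  shows "norm2 w \<le> C"
proof -
  have test': "paired_below w C \<phi>" if "test_function \<phi>" for \<phi>
    using that test test_function_square_integrable by (auto simp: paired_below_def)
  have cw: "square_integrable (\<lambda>z. cnj (w z))" using w by (rule square_integrable_cnj)
  then have [measurable]: "(\<lambda>z. cnj (w z)) \<in> borel_measurable lborel" by (simp add: square_integrable_def)
  then have "(\<lambda>z. cnj (w z)) \<in> borel_measurable lebesgue"
    by (rule measurable_completion)
  then have "(\<lambda>z. cnj (w z)) measurable_on UNIV"
    by (intro lebesgue_measurable_imp_measurable_on) auto
  then obtain N g where N: "negligible N" and g: "\<And>n. continuous_on UNIV (g n)"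
    and gw: "\<And>z. z \<notin> N \<Longrightarrow> (\<lambda>n. g n z) \<longlonglongrightarrow> cnj (w z)"
    by (auto simp: measurable_on_def)
  have "AE z in lebesgue. z \<notin> N"
    using N by (intro AE_not_in) (simp add: negligible_iff_null_sets)
  then have "AE z in lborel. z \<notin> N" by (simp add: AE_completion_iff)
  then have lim: "AE z in lborel. (\<lambda>n. g n z) \<longlonglongrightarrow> cnj (w z)"
    by eventually_elim (rule gw)
  have trunc: "paired_below w C (\<lambda>z. if z \<in> square M then clamp_to M (cnj (w z)) else 0)" if M: "M > 0" for M
  proof (rule paired_below_limit[OF w])
    note cont = clamp_to_continuous[OF M]
    show "paired_below w C (\<lambda>z. if z \<in> square M then clamp_to M (g n z) else 0)" for n
      by (rule paired_below_continuous[OF w test']) (auto intro: continuous_on_compose2[OF cont g])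
    show "square_integrable (\<lambda>z. if z \<in> square M then of_real M else 0)"
      by (rule square_integrable_square[where M = M]) (use M in auto)
    show "cmod (if z \<in> square M then clamp_to M (g n z) else 0)
        \<le> cmod (if z \<in> square M then of_real M else 0)" for n z
      using clamp_to_bounds(1)[OF M] M by simp
    show "AE z in lborel. (\<lambda>n. if z \<in> square M then clamp_to M (g n z) else 0) \<longlonglongrightarrow>
        (if z \<in> square M then clamp_to M (cnj (w z)) else 0)"
      using lim
    proof eventually_elim
      case (elim z)
      have "isCont (clamp_to M) (cnj (w z))"
        using cont by (simp add: continuous_on_eq_continuous_at)
      from isCont_tendsto_compose[OF this elim] show ?case by auto
    qed
    have [measurable]: "clamp_to M \<in> borel_measurable borel"
      by (rule borel_measurable_continuous_onI[OF cont])
    show "(\<lambda>z. if z \<in> square M then clamp_to M (cnj (w z)) else 0) \<in> borel_measurable lborel"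
      by measurable
  qed
  have "paired_below w C (\<lambda>z. cnj (w z))"
  proof (rule paired_below_limit[OF w trunc cw])
    show "real (Suc n) > 0" for n by simp
    show "cmod (if z \<in> square (real (Suc n)) then clamp_to (real (Suc n)) (cnj (w z)) else 0) \<le> cmod (cnj (w z))" for n z
      using clamp_to_bounds(2)[of "real (Suc n)" "cnj (w z)"] by auto
    show "AE z in lborel. (\<lambda>n. if z \<in> square (real (Suc n)) then clamp_to (real (Suc n)) (cnj (w z)) else 0) \<longlonglongrightarrow> cnj (w z)"
    proof (rule AE_I2, rule tendsto_eventually)
      fix z
      \<comment> \<open>Every point lies in the squares and below the clamping level from some index on.\<close>
      obtain n0 :: nat where n0: "max (cmod z) (cmod (w z)) < real n0" using reals_Archimedean2 by blast
      show "\<forall>\<^sub>F n in sequentially. (if z \<in> square (real (Suc n)) then clamp_to (real (Suc n)) (cnj (w z)) else 0) = cnj (w z)"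
        using eventually_ge_at_top[of n0]
      proof eventually_elim
        case (elim n)
        then have "cmod z < real (Suc n)" "cmod (cnj (w z)) \<le> real (Suc n)" using n0 by auto
        moreover from this have "z \<in> square (real (Suc n))"
          using abs_Re_le_cmod[of z] abs_Im_le_cmod[of z] by (simp add: square_def)
        ultimately show ?case using clamp_to_bounds(3)[of "real (Suc n)" "cnj (w z)"] by simp
      qed
    qed
  qed measurable
  moreover have "cmod (\<integral>z. w z * cnj (w z) \<partial>lborel) = (norm2 w)\<^sup>2"
    by (simp add: integral_norm_square norm_power)
  ultimately have "norm2 w * norm2 w \<le> C * norm2 w"
    by (simp add: paired_below_def power2_eq_square)
  then show ?thesis using C norm2_nonneg[of w] by (cases "norm2 w = 0") (auto simp: mult_le_cancel_right)
qed

section \<open>Magnetic translations\<close>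

lemma lborel_integral_translate:
  fixes f :: "complex \<Rightarrow> 'b :: {banach, second_countable_topology}"
  assumes "f \<in> borel_measurable lborel"
  shows "(\<integral>z. f (z + v) \<partial>lborel) = (\<integral>z. f z \<partial>lborel)"
    and "integrable lborel (\<lambda>z. f (z + v)) \<longleftrightarrow> integrable lborel f"
proof -
  have f: "f \<in> borel_measurable borel" using assms by simp
  have T: "(+) v \<in> measurable lborel borel" by measurable
  show "(\<integral>z. f (z + v) \<partial>lborel) = (\<integral>z. f z \<partial>lborel)"
    using integral_distr[OF T f] by (simp add: lborel_distr_plus add.commute)
  show "integrable lborel (\<lambda>z. f (z + v)) \<longleftrightarrow> integrable lborel f"
    using integrable_distr_eq[OF T f] by (simp add: lborel_distr_plus add.commute)
qed

definition phase :: "complex \<Rightarrow> complex \<Rightarrow> complex" where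
  "phase v z = cis (2 * pi * Im (v * cnj z))"

text \<open>For \<open>v = s\<close> and \<open>v = \<i>s\<close> with real \<open>s\<close> these are the unitary groups generated by the magnetic
derivatives \<open>\<partial>\<^sub>x - 2\<pi>\<i>y\<close> and \<open>\<partial>\<^sub>y + 2\<pi>\<i>x\<close>.\<close>

definition mag_translate :: "complex \<Rightarrow> (complex \<Rightarrow> complex) \<Rightarrow> complex \<Rightarrow> complex" where
  "mag_translate v f z = f (z + v) * phase v z"

text \<open>The transpose of \<open>mag_translate v\<close> with respect to the bilinear pairing, see
\<open>pairing_mag_translate\<close>.\<close>

definition mag_translate_dual :: "complex \<Rightarrow> (complex \<Rightarrow> complex) \<Rightarrow> complex \<Rightarrow> complex" where
  "mag_translate_dual v \<phi> z = \<phi> (z - v) * phase v z"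

text \<open>The transpose of the magnetic derivative \<open>D\<^sub>v = \<partial>\<^sub>v + 2\<pi>\<i> Im(v z\<^sup>*)\<close> in the direction \<open>v\<close>: the sign of
the partial derivatives changes, that of the potential does not.\<close>

definition dual_generator :: "complex \<Rightarrow> (complex \<Rightarrow> complex) \<Rightarrow> complex \<Rightarrow> complex" where
  "dual_generator v \<phi> z = 2 * of_real pi * \<i> * of_real (Im (v * cnj z)) * \<phi> z
     - (of_real (Re v) * partial_x \<phi> z + of_real (Im v) * partial_y \<phi> z)"

lemma norm_phase [simp]: "cmod (phase v z) = 1"
  by (simp add: phase_def)

lemma Ck_phase: "Ck k (phase v)"
proof -
  let ?g = "\<lambda>n t. \<i> ^ n * cis t"
  have "(?g n has_vector_derivative ?g (Suc n) t) (at t)" for n t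
    unfolding has_vector_derivative_def
    by (rule derivative_eq_intros refl | simp add: algebra_simps)+
  from Ck_compose_affine[of ?g, OF this, where n = 0 and k = k and a = "2 * pi * Im v" and b = "- 2 * pi * Re v" and c = 0]
  show ?thesis by (simp add: phase_def[abs_def] algebra_simps)
qed

lemma phase_measurable [measurable]: "phase v \<in> borel_measurable borel"
  using Ck_phase[of 0 v] by (simp add: borel_measurable_continuous_onI)

lemma mag_translate_0 [simp]: "mag_translate 0 f = f"
  by (simp add: mag_translate_def phase_def fun_eq_iff)

lemma mag_translate_dual_0 [simp]: "mag_translate_dual 0 f = f"
  by (simp add: mag_translate_dual_def phase_def fun_eq_iff)

lemma mag_translate_square_integrable:
  assumes "square_integrable f" shows "square_integrable (mag_translate v f)"
  and "norm2 (mag_translate v f) = norm2 f"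
proof -
  have [measurable]: "f \<in> borel_measurable borel" and i: "integrable lborel (\<lambda>z. (cmod (f z))\<^sup>2)"
    using assms by (auto simp: square_integrable_def)
  have m: "(\<lambda>z. (cmod (f z))\<^sup>2) \<in> borel_measurable lborel" by measurable
  have n: "(cmod (mag_translate v f z))\<^sup>2 = (cmod (f (z + v)))\<^sup>2" for z
    by (simp add: mag_translate_def norm_mult)
  have "(\<lambda>z. f (z + v) * phase v z) \<in> borel_measurable borel" by measurable
  then show "square_integrable (mag_translate v f)"
    unfolding square_integrable_def n lborel_integral_translate(2)[OF m]
    using i by (simp add: mag_translate_def[abs_def])
  show "norm2 (mag_translate v f) = norm2 f"
    unfolding norm2_def n lborel_integral_translate(1)[OF m] ..
qed

lemma mag_translate_dual_eq: "mag_translate_dual v \<phi> z = cnj (mag_translate (- v) (\<lambda>z. cnj (\<phi> z)) z)"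
  by (simp add: mag_translate_dual_def mag_translate_def phase_def cis_cnj algebra_simps)

lemma norm2_mag_translate_dual:
  assumes "square_integrable \<phi>" shows "norm2 (mag_translate_dual v \<phi>) = norm2 \<phi>"
  unfolding mag_translate_dual_eq[abs_def] norm2_cnj mag_translate_square_integrable(2)[OF square_integrable_cnj[OF assms]] ..

lemma test_function_mag_translate_dual:
  assumes "test_function \<phi>" shows "test_function (mag_translate_dual v \<phi>)"
  using test_function_mult[OF Ck_phase test_function_translate[OF assms], of v "- v"]
  by (simp add: mag_translate_dual_def[abs_def] mult.commute)

lemma test_function_dual_generator:
  assumes "test_function \<phi>" shows "test_function (dual_generator v \<phi>)"
proof -
  have "Ck k (\<lambda>z. of_real (Im (v * cnj z)))" for k
    by (intro Ck_real_polynomial real_polynomial_function.intros(1) bounded_linear_compose[OF bounded_linear_Im]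
        bounded_linear_compose[OF bounded_linear_mult_right bounded_linear_cnj])
  then have "Ck k (\<lambda>z. 2 * of_real pi * \<i> * of_real (Im (v * cnj z)))" for k
    by (rule Ck_mult[OF Ck_const])
  then have "test_function (\<lambda>z. 2 * of_real pi * \<i> * of_real (Im (v * cnj z)) * \<phi> z
      + (of_real (- Re v) * partial_x \<phi> z + of_real (- Im v) * partial_y \<phi> z))"
    using test_function_mult test_function_add test_function_partials[OF assms] assms Ck_const by meson
  then show ?thesis by (simp add: dual_generator_def[abs_def] algebra_simps)
qed

lemma pairing_mag_translate:
  assumes "square_integrable f" "square_integrable \<phi>"
  shows "(\<integral>z. mag_translate v f z * \<phi> z \<partial>lborel) = (\<integral>z. f z * mag_translate_dual v \<phi> z \<partial>lborel)"
proof -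
  have [measurable]: "f \<in> borel_measurable borel" "\<phi> \<in> borel_measurable borel"
    using assms by (auto simp: square_integrable_def)
  have "(\<lambda>z. f z * (\<phi> (z - v) * phase v z)) \<in> borel_measurable lborel" by measurable
  from lborel_integral_translate(1)[OF this, of v] show ?thesis
    by (simp add: mag_translate_def mag_translate_dual_def phase_def algebra_simps)
qed

text \<open>The Weyl relation in weak form.  Substituting \<open>z + w\<close> for \<open>z\<close> turns one integrand into the
other up to the phase, because \<open>Im(v w\<^sup>*)\<close> is bilinear and alternating.\<close>

lemma mag_translate_inner:
  assumes "square_integrable f"
  shows "(\<integral>z. mag_translate v f z * cnj (mag_translate w f z) \<partial>lborel)
    = cis (- (2 * pi * Im (v * cnj w))) * (\<integral>z. mag_translate (v - w) f z * cnj (f z) \<partial>lborel)"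
proof -
  have [measurable]: "f \<in> borel_measurable borel"
    using assms by (auto simp: square_integrable_def)
  have "(\<lambda>z. f (z + (v - w)) * phase (v - w) z * cnj (f z)) \<in> borel_measurable lborel"
    using borel_measurable_continuous_on[OF continuous_on_cnj[OF continuous_on_id], of f borel] by simp
  from lborel_integral_translate(1)[OF this, of w]
  have "(\<integral>z. mag_translate (v - w) f z * cnj (f z) \<partial>lborel)
      = (\<integral>z. f (z + v) * phase (v - w) (z + w) * cnj (f (z + w)) \<partial>lborel)"
    by (simp add: mag_translate_def algebra_simps)
  also have "\<dots> = (\<integral>z. cis (2 * pi * Im (v * cnj w)) * (mag_translate v f z * cnj (mag_translate w f z)) \<partial>lborel)"
  proof (rule Bochner_Integration.integral_cong[OF refl])
    fix z
    have "phase (v - w) (z + w) = cis (2 * pi * Im (v * cnj w)) * (phase v z * cnj (phase w z))"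
      unfolding phase_def cis_cnj cis_mult by (rule arg_cong[of _ _ cis]) (simp add: algebra_simps)
    then show "f (z + v) * phase (v - w) (z + w) * cnj (f (z + w))
      = cis (2 * pi * Im (v * cnj w)) * (mag_translate v f z * cnj (mag_translate w f z))"
      by (simp add: mag_translate_def)
  qed
  also have "\<dots> = cis (2 * pi * Im (v * cnj w)) * (\<integral>z. mag_translate v f z * cnj (mag_translate w f z) \<partial>lborel)"
    by (rule integral_mult_right_zero)
  finally show ?thesis
    by (simp add: mult.assoc[symmetric] cis_mult del: times_complex.sel)
qed

text \<open>Translations along one line carry no cocycle, since \<open>Im(v v\<^sup>*) = 0\<close>, and so form a group.  This
reduces differentiation at \<open>s\<close> to differentiation at 0.\<close>

lemma mag_translate_dual_add:
  "mag_translate_dual (of_real h * v) (mag_translate_dual (of_real s * v) \<phi>)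
     = mag_translate_dual (of_real (s + h) * v) \<phi>"
proof
  fix z
  have "phase (of_real s * v) (z - of_real h * v) * phase (of_real h * v) z = phase (of_real (s + h) * v) z"
    unfolding phase_def cis_mult by (rule arg_cong[of _ _ cis]) (simp add: algebra_simps)
  then show "mag_translate_dual (of_real h * v) (mag_translate_dual (of_real s * v) \<phi>) z
     = mag_translate_dual (of_real (s + h) * v) \<phi> z"
    by (simp add: mag_translate_dual_def algebra_simps)
qed

lemma mag_translate_dual_has_derivative:
  assumes "test_function \<phi>"
  shows "((\<lambda>s. mag_translate_dual (of_real s * v) \<phi> z) has_vector_derivative
     mag_translate_dual (of_real s * v) (dual_generator v \<phi>) z) (at s)"
proof -
  let ?y = "z - of_real s * v"
  have "Ck (Suc 0) \<phi>" using assms by (rule test_function_smooth)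
  then have "\<phi> differentiable (at ?y)" by simp
  then have \<phi>: "(\<phi> has_derivative (\<lambda>h. of_real (Re h) * partial_x \<phi> ?y + of_real (Im h) * partial_y \<phi> ?y)) (at ?y)"
    by (rule has_derivative_partials)
  have line: "((\<lambda>s. z - of_real s * v) has_derivative (\<lambda>h. - (of_real h * v))) (at s)"
    by (auto intro!: derivative_eq_intros)
  have 1: "((\<lambda>s. \<phi> (z - of_real s * v)) has_derivative
      (\<lambda>h. of_real (Re (- (of_real h * v))) * partial_x \<phi> ?y + of_real (Im (- (of_real h * v))) * partial_y \<phi> ?y)) (at s)"
    using has_derivative_compose[OF line \<phi>] .
  have arg: "((\<lambda>s. 2 * pi * Im (of_real s * v * cnj z)) has_derivative (\<lambda>h. h * (2 * pi * Im (v * cnj z)))) (at s)"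
    by (auto intro!: derivative_eq_intros simp: algebra_simps)
  have 2: "((\<lambda>s. phase (of_real s * v) z) has_derivative
      (\<lambda>h. (h * (2 * pi * Im (v * cnj z))) *\<^sub>R (\<i> * phase (of_real s * v) z))) (at s)"
    unfolding phase_def using has_derivative_cis[OF arg] .
  have "Im (v * cnj ?y) = Im (v * cnj z)"
    by (simp add: algebra_simps)
  then show ?thesis
    unfolding has_vector_derivative_def mag_translate_dual_def dual_generator_def
    by (intro has_derivative_eq_rhs[OF has_derivative_mult[OF 1 2]])
       (simp add: fun_eq_iff scaleR_conv_of_real algebra_simps)
qed

section \<open>Weak derivatives control magnetic translations\<close>

text \<open>The mean value inequality on a symmetric interval, so that the sign of \<open>s\<close> does not matter.\<close>

lemma norm_diff_le_vector_derivative: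
  fixes g :: "real \<Rightarrow> complex"
  assumes "\<And>t. \<bar>t\<bar> \<le> \<bar>s\<bar> \<Longrightarrow> (g has_vector_derivative g' t) (at t)"
    and "\<And>t. \<bar>t\<bar> \<le> \<bar>s\<bar> \<Longrightarrow> cmod (g' t) \<le> B"
  shows "cmod (g s - g 0) \<le> B * \<bar>s\<bar>"
proof -
  have "norm (g s - g 0) \<le> B * norm (s - 0)"
  proof (rule differentiable_bound[where S = "{-\<bar>s\<bar>..\<bar>s\<bar>}" and f' = "\<lambda>t h. h *\<^sub>R g' t"])
    fix t assume "t \<in> {-\<bar>s\<bar>..\<bar>s\<bar>}"
    then have t: "\<bar>t\<bar> \<le> \<bar>s\<bar>" by auto
    show "(g has_derivative (\<lambda>h. h *\<^sub>R g' t)) (at t within {-\<bar>s\<bar>..\<bar>s\<bar>})"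
      using assms(1)[OF t] unfolding has_vector_derivative_def by (rule has_derivative_at_withinI)
    show "onorm (\<lambda>h. h *\<^sub>R g' t) \<le> B"
      using assms(2)[OF t] by (simp add: onorm_scaleR_left bounded_linear_ident onorm_id)
  qed auto
  then show ?thesis by simp
qed

text \<open>The derivative in \<open>s\<close> is a translate of the bounded function \<open>dual_generator v \<phi>\<close>.  For
\<open>\<bar>s\<bar> \<le> 1\<close> all translates live in one square, so a constant on this square serves as the bound.\<close>

lemma mag_translate_dual_Lipschitz:
  assumes "test_function \<phi>"
  obtains d where "square_integrable d"
    "\<And>s z. \<bar>s\<bar> \<le> 1 \<Longrightarrow> cmod (mag_translate_dual (of_real s * v) \<phi> z - \<phi> z) \<le> \<bar>s\<bar> * cmod (d z)"
proof -
  obtain M where M: "M > 0" "\<And>z. cmod (dual_generator v \<phi> z) \<le> M"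
    using test_function_bounded[OF test_function_dual_generator[OF assms]] by metis
  obtain R where R: "R > 0" "\<And>z. R < cmod z \<Longrightarrow> \<phi> z = 0"
    using test_function_support[OF assms] by metis
  define d where "d = (\<lambda>z. if z \<in> square (R + cmod v + 1) then complex_of_real M else 0)"
  show thesis
  proof (rule that)
    show "square_integrable d"
      unfolding d_def by (rule square_integrable_square[where M = M]) (use M in auto)
    fix s :: real and z :: complex assume s: "\<bar>s\<bar> \<le> 1"
    have "cmod (mag_translate_dual (of_real s * v) \<phi> z - mag_translate_dual (of_real 0 * v) \<phi> z) \<le> M * \<bar>s\<bar>"
      by (rule norm_diff_le_vector_derivative[OF mag_translate_dual_has_derivative[OF assms]])
         (simp add: mag_translate_dual_def norm_mult M)
    then have le: "cmod (mag_translate_dual (of_real s * v) \<phi> z - \<phi> z) \<le> M * \<bar>s\<bar>"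
      by (simp add: mag_translate_dual_def phase_def)
    show "cmod (mag_translate_dual (of_real s * v) \<phi> z - \<phi> z) \<le> \<bar>s\<bar> * cmod (d z)"
    proof (cases "z \<in> square (R + cmod v + 1)")
      case True
      with le M(1) show ?thesis by (simp add: d_def mult.commute)
    next
      case False
      then have z: "R + cmod v < cmod z"
        using abs_Re_le_cmod[of z] abs_Im_le_cmod[of z] by (auto simp: square_def)
      have "cmod (of_real s * v) \<le> 1 * cmod v"
        unfolding norm_mult using s by (intro mult_right_mono) auto
      then have "R < cmod (z - of_real s * v)"
        using z norm_triangle_ineq2[of z "of_real s * v"] by linarith
      moreover have "R < cmod z" using z norm_ge_zero[of v] by linarith
      ultimately show ?thesis by (simp add: mag_translate_dual_def R(2))
    qed
  qed
qed

text \<open>Subtracting the linear term leaves a function of \<open>s\<close> whose derivative is the increment of the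
translates of \<open>dual_generator v \<phi>\<close>.  This is again a test function, so its increment is of first
order, and the remainder is of second order.\<close>

lemma mag_translate_dual_Taylor:
  assumes "test_function \<phi>"
  obtains d where "square_integrable d"
    "\<And>s z. \<bar>s\<bar> \<le> 1 \<Longrightarrow> cmod (mag_translate_dual (of_real s * v) \<phi> z - \<phi> z - of_real s * dual_generator v \<phi> z)
       \<le> s\<^sup>2 * cmod (d z)"
proof -
  obtain d where d: "square_integrable d" "\<And>s z. \<bar>s\<bar> \<le> 1 \<Longrightarrow>
      cmod (mag_translate_dual (of_real s * v) (dual_generator v \<phi>) z - dual_generator v \<phi> z) \<le> \<bar>s\<bar> * cmod (d z)"
    using mag_translate_dual_Lipschitz[OF test_function_dual_generator[OF assms]] by metis
  show thesis
  proof (rule that[OF d(1)])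
    fix s :: real and z :: complex assume s: "\<bar>s\<bar> \<le> 1"
    let ?g = "\<lambda>s. mag_translate_dual (of_real s * v) \<phi> z - s *\<^sub>R dual_generator v \<phi> z"
    have "cmod (?g s - ?g 0) \<le> (\<bar>s\<bar> * cmod (d z)) * \<bar>s\<bar>"
    proof (rule norm_diff_le_vector_derivative)
      fix t :: real assume t: "\<bar>t\<bar> \<le> \<bar>s\<bar>"
      show "(?g has_vector_derivative
          mag_translate_dual (of_real t * v) (dual_generator v \<phi>) z - dual_generator v \<phi> z) (at t)"
        by (rule has_vector_derivative_diff[OF mag_translate_dual_has_derivative[OF assms]])
           (auto intro!: derivative_eq_intros)
      have "cmod (mag_translate_dual (of_real t * v) (dual_generator v \<phi>) z - dual_generator v \<phi> z)
          \<le> \<bar>t\<bar> * cmod (d z)"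
        using t s by (intro d(2)) simp
      also have "\<dots> \<le> \<bar>s\<bar> * cmod (d z)" using t by (intro mult_right_mono) auto
      finally show "cmod (mag_translate_dual (of_real t * v) (dual_generator v \<phi>) z - dual_generator v \<phi> z)
          \<le> \<bar>s\<bar> * cmod (d z)" .
    qed
    moreover have "(\<bar>s\<bar> * cmod (d z)) * \<bar>s\<bar> = s\<^sup>2 * cmod (d z)"
      by (simp add: power2_eq_square)
    moreover have "?g s - ?g 0 = mag_translate_dual (of_real s * v) \<phi> z - \<phi> z - of_real s * dual_generator v \<phi> z"
      by (simp add: mag_translate_dual_def phase_def scaleR_conv_of_real)
    ultimately show "cmod (mag_translate_dual (of_real s * v) \<phi> z - \<phi> z - of_real s * dual_generator v \<phi> z)
       \<le> s\<^sup>2 * cmod (d z)" by (simp only:)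
  qed
qed

definition weak_mag_derivative :: "complex \<Rightarrow> (complex \<Rightarrow> complex) \<Rightarrow> (complex \<Rightarrow> complex) \<Rightarrow> bool" where
  "weak_mag_derivative v f a \<longleftrightarrow> square_integrable f \<and> square_integrable a \<and>
     (\<forall>\<phi>. test_function \<phi> \<longrightarrow> (\<integral>z. a z * \<phi> z \<partial>lborel) = (\<integral>z. f z * dual_generator v \<phi> z \<partial>lborel))"

text \<open>The square integrable bound in the Taylor estimate makes the remainder integrable against
\<open>f\<close>, so the pairing may be differentiated under the integral.  The generator is then applied to the
translated test function, where the weak derivative takes over.\<close>

lemma pairing_has_derivative:
  assumes f: "weak_mag_derivative v f a" and \<phi>: "test_function \<phi>"
  shows "((\<lambda>s. \<integral>z. f z * mag_translate_dual (of_real s * v) \<phi> z \<partial>lborel) has_vector_derivative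
    (\<integral>z. a z * mag_translate_dual (of_real s * v) \<phi> z \<partial>lborel)) (at s)"
proof -
  let ?F = "\<lambda>s. \<integral>z. f z * mag_translate_dual (of_real s * v) \<phi> z \<partial>lborel"
  let ?\<psi> = "mag_translate_dual (of_real s * v) \<phi>"
  let ?D = "\<integral>z. a z * ?\<psi> z \<partial>lborel"
  have sf: "square_integrable f" using f by (simp add: weak_mag_derivative_def)
  have \<psi>: "test_function ?\<psi>" using \<phi> by (rule test_function_mag_translate_dual)
  have D: "?D = (\<integral>z. f z * dual_generator v ?\<psi> z \<partial>lborel)"
    using f \<psi> by (simp add: weak_mag_derivative_def)
  obtain d where d: "square_integrable d"
    "\<And>h z. \<bar>h\<bar> \<le> 1 \<Longrightarrow> cmod (mag_translate_dual (of_real h * v) ?\<psi> z - ?\<psi> z - of_real h * dual_generator v ?\<psi> z)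
       \<le> h\<^sup>2 * cmod (d z)"
    using mag_translate_dual_Taylor[OF \<psi>] by metis
  define K where "K = (\<integral>z. cmod (f z * d z) \<partial>lborel)"
  have est: "cmod (?F (s + h) - ?F s - h *\<^sub>R ?D) \<le> h\<^sup>2 * K" if h: "\<bar>h\<bar> \<le> 1" for h
  proof -
    let ?r = "\<lambda>z. f z * (mag_translate_dual (of_real h * v) ?\<psi> z - ?\<psi> z - of_real h * dual_generator v ?\<psi> z)"
    have i1: "integrable lborel (\<lambda>z. f z * mag_translate_dual (of_real h * v) ?\<psi> z)"
      and i2: "integrable lborel (\<lambda>z. f z * ?\<psi> z)"
      and i3: "integrable lborel (\<lambda>z. f z * dual_generator v ?\<psi> z)"
      by (intro square_integrable_mult_integrable sf test_function_square_integrable test_function_mag_translate_dual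
          test_function_dual_generator \<phi>)+
    have i3': "integrable lborel (\<lambda>z. of_real h * (f z * dual_generator v ?\<psi> z))"
      using i3 by simp
    have r: "?r = (\<lambda>z. f z * mag_translate_dual (of_real h * v) ?\<psi> z - f z * ?\<psi> z - of_real h * (f z * dual_generator v ?\<psi> z))"
      by (simp add: fun_eq_iff algebra_simps)
    have ir: "integrable lborel ?r"
      unfolding r by (intro Bochner_Integration.integrable_diff i1 i2 i3')
    have "(\<integral>z. ?r z \<partial>lborel) = (\<integral>z. f z * mag_translate_dual (of_real h * v) ?\<psi> z \<partial>lborel)
        - (\<integral>z. f z * ?\<psi> z \<partial>lborel) - of_real h * (\<integral>z. f z * dual_generator v ?\<psi> z \<partial>lborel)"
      unfolding r using i1 i2 i3' by (simp add: Bochner_Integration.integrable_diff)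
    also have "\<dots> = ?F (s + h) - ?F s - h *\<^sub>R ?D"
      by (simp only: mag_translate_dual_add D scaleR_conv_of_real)
    finally have "cmod (?F (s + h) - ?F s - h *\<^sub>R ?D) = cmod (\<integral>z. ?r z \<partial>lborel)" by (rule arg_cong[OF sym])
    also have "\<dots> \<le> (\<integral>z. cmod (?r z) \<partial>lborel)" by (rule integral_norm_bound)
    also have "\<dots> \<le> (\<integral>z. h\<^sup>2 * cmod (f z * d z) \<partial>lborel)"
    proof (rule integral_mono)
      show "integrable lborel (\<lambda>z. cmod (?r z))" by (rule integrable_norm[OF ir])
      show "integrable lborel (\<lambda>z. h\<^sup>2 * cmod (f z * d z))"
        by (intro integrable_mult_right integrable_norm square_integrable_mult_integrable sf d(1))
      show "cmod (?r z) \<le> h\<^sup>2 * cmod (f z * d z)" for z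
        using mult_left_mono[OF d(2)[OF h, of z], of "cmod (f z)"] by (simp add: norm_mult mult_ac)
    qed
    finally show ?thesis by (simp add: K_def)
  qed
  have "((\<lambda>h. norm (?F (s + h) - ?F s - h *\<^sub>R ?D) / norm h) \<longlongrightarrow> 0) (at 0)"
  proof (rule Lim_null_comparison)
    have "\<forall>\<^sub>F h in at (0::real). \<bar>h\<bar> < 1 \<and> h \<noteq> 0"
      unfolding eventually_at by (intro exI[of _ 1]) (auto simp: dist_real_def)
    then show "\<forall>\<^sub>F h in at 0. norm (norm (?F (s + h) - ?F s - h *\<^sub>R ?D) / norm h) \<le> \<bar>h\<bar> * K"
    proof eventually_elim
      case (elim h)
      then show ?case using est[of h]
        by (simp add: pos_divide_le_eq power2_eq_square abs_mult[symmetric] mult_ac)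
    qed
    show "((\<lambda>h. \<bar>h\<bar> * K) \<longlongrightarrow> 0) (at 0)"
      by (auto intro!: tendsto_eq_intros)
  qed
  then show ?thesis
    unfolding has_vector_derivative_def has_derivative_at
    by (simp add: bounded_linear_scaleR_left)
qed

text \<open>The quantitative form of the statement that \<open>D\<^sub>v\<close> generates the magnetic translations.  It
holds with weak derivatives because only its pairings with test functions have to be estimated.\<close>

lemma norm2_mag_translate_diff:
  assumes f: "weak_mag_derivative v f a"
  shows "norm2 (\<lambda>z. mag_translate (of_real s * v) f z - f z) \<le> \<bar>s\<bar> * norm2 a"
proof (rule norm2_le_by_test_functions)
  have sf: "square_integrable f" and sa: "square_integrable a" using f by (auto simp: weak_mag_derivative_def)
  show "square_integrable (\<lambda>z. mag_translate (of_real s * v) f z - f z)"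
    by (intro square_integrable_diff mag_translate_square_integrable sf)
  show "0 \<le> \<bar>s\<bar> * norm2 a" by simp
  fix \<phi> assume \<phi>: "test_function \<phi>"
  let ?F = "\<lambda>s. \<integral>z. f z * mag_translate_dual (of_real s * v) \<phi> z \<partial>lborel"
  have s\<phi>: "square_integrable \<phi>" using \<phi> by (rule test_function_square_integrable)
  have "cmod (?F s - ?F 0) \<le> (norm2 a * norm2 \<phi>) * \<bar>s\<bar>"
  proof (rule norm_diff_le_vector_derivative[OF pairing_has_derivative[OF f \<phi>]])
    show "cmod (\<integral>z. a z * mag_translate_dual (of_real t * v) \<phi> z \<partial>lborel) \<le> norm2 a * norm2 \<phi>" for t
      using Cauchy_Schwarz_norm2[OF sa test_function_square_integrable[OF test_function_mag_translate_dual[OF \<phi>]]]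
        norm2_mag_translate_dual[OF s\<phi>] by metis
  qed
  moreover have "(\<integral>z. (mag_translate (of_real s * v) f z - f z) * \<phi> z \<partial>lborel) = ?F s - ?F 0"
  proof -
    have "(\<integral>z. (mag_translate (of_real s * v) f z - f z) * \<phi> z \<partial>lborel)
      = (\<integral>z. mag_translate (of_real s * v) f z * \<phi> z \<partial>lborel) - (\<integral>z. mag_translate (of_real 0 * v) f z * \<phi> z \<partial>lborel)"
      unfolding left_diff_distrib
      by (subst Bochner_Integration.integral_diff)
         (auto intro!: square_integrable_mult_integrable mag_translate_square_integrable sf s\<phi>)
    then show ?thesis by (simp only: pairing_mag_translate[OF sf s\<phi>])
  qed
  ultimately show "cmod (\<integral>z. (mag_translate (of_real s * v) f z - f z) * \<phi> z \<partial>lborel) \<le> \<bar>s\<bar> * norm2 a * norm2 \<phi>"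
    by (simp add: mult_ac)
qed

section \<open>The uncertainty principle\<close>

text \<open>Expansion around \<open>f\<close>: the first summand is of second order in the increments.\<close>

lemma inner_product_expand:
  assumes f: "square_integrable f" and p: "square_integrable p" and q: "square_integrable q"
  shows "(\<integral>z. p z * cnj (q z) \<partial>lborel)
     = (\<integral>z. (p z - f z) * cnj (q z - f z) \<partial>lborel) + (\<integral>z. p z * cnj (f z) \<partial>lborel)
       + (\<integral>z. f z * cnj (q z) \<partial>lborel) - of_real ((norm2 f)\<^sup>2)"
proof -
  have i: "integrable lborel (\<lambda>z. p z * cnj (q z))" "integrable lborel (\<lambda>z. p z * cnj (f z))"
    "integrable lborel (\<lambda>z. f z * cnj (q z))" "integrable lborel (\<lambda>z. f z * cnj (f z))"
    by (intro square_integrable_mult_integrable square_integrable_cnj f p q)+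
  have "(\<integral>z. (p z - f z) * cnj (q z - f z) \<partial>lborel)
    = (\<integral>z. p z * cnj (q z) - p z * cnj (f z) - f z * cnj (q z) + f z * cnj (f z) \<partial>lborel)"
    by (simp add: algebra_simps)
  also have "\<dots> = (\<integral>z. p z * cnj (q z) \<partial>lborel) - (\<integral>z. p z * cnj (f z) \<partial>lborel)
     - (\<integral>z. f z * cnj (q z) \<partial>lborel) + (\<integral>z. f z * cnj (f z) \<partial>lborel)"
    using i by simp
  finally show ?thesis by (simp add: integral_norm_square)
qed

text \<open>The uncertainty principle for finite increments of length \<open>sqrt t\<close> in both directions.  The
inner products \<open>P\<close> and \<open>Q\<close> in the proof have the same first-order terms in \<open>inner_product_expand\<close>,
so their difference is a difference of two second-order terms.  By the Weyl relation it also equals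
\<open>2\<i> sin(2\<pi>t)\<close> times a number of modulus \<open>\<bar>P\<bar>\<close>, and \<open>P\<close> tends to \<open>\<parallel>f\<parallel>\<^sup>2\<close>.\<close>

lemma commutator_estimate:
  assumes A: "weak_mag_derivative 1 f a" and B: "weak_mag_derivative \<i> f b" and t: "t > 0"
  shows "\<bar>sin (2 * pi * t)\<bar> * ((norm2 f)\<^sup>2 - sqrt t * ((norm2 a + norm2 b) * norm2 f) - t * (norm2 a * norm2 b)) \<le> t * (norm2 a * norm2 b)"
proof -
  define s where "s = sqrt t"
  have s: "s > 0" "s * s = t" using t by (auto simp: s_def)
  have f: "square_integrable f" using A by (simp add: weak_mag_derivative_def)
  define T where "T = (\<lambda>v. mag_translate v f)"
  define G where "G = (\<lambda>v. \<integral>z. T v z * cnj (f z) \<partial>lborel)"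
  define E where "E = (\<lambda>v w. \<integral>z. (T v z - f z) * cnj (T w z - f z) \<partial>lborel)"
  have T: "square_integrable (T v)" for v unfolding T_def by (rule mag_translate_square_integrable[OF f])
  have dT: "square_integrable (\<lambda>z. T v z - f z)" for v by (rule square_integrable_diff[OF T f])
  have inner: "(\<integral>z. T v z * cnj (T w z) \<partial>lborel) = cis (- (2 * pi * Im (v * cnj w))) * G (v - w)" for v w
    unfolding T_def G_def by (rule mag_translate_inner[OF f])
  have "(\<integral>z. f z * cnj (T v z) \<partial>lborel) = G (- v)" for v
    using inner[of 0 v] by (simp add: T_def)
  then have expand: "(\<integral>z. T v z * cnj (T w z) \<partial>lborel) = E v w + G v + G (- w) - of_real ((norm2 f)\<^sup>2)" for v w
    unfolding E_def using inner_product_expand[OF f T T, of v w] by (simp add: G_def)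
  have la: "norm2 (\<lambda>z. T (of_real r) z - f z) \<le> \<bar>r\<bar> * norm2 a" for r
    using norm2_mag_translate_diff[OF A, of r] by (simp add: T_def)
  have lb: "norm2 (\<lambda>z. T (of_real r * \<i>) z - f z) \<le> \<bar>r\<bar> * norm2 b" for r
    using norm2_mag_translate_diff[OF B, of r] by (simp add: T_def)
  have E_le: "cmod (E v w) \<le> norm2 (\<lambda>z. T v z - f z) * norm2 (\<lambda>z. T w z - f z)" for v w
    unfolding E_def using Cauchy_Schwarz_norm2[OF dT square_integrable_cnj[OF dT], of v w] by (simp only: norm2_cnj)
  let ?u = "complex_of_real s" and ?v = "of_real s * \<i>"
  have E1: "cmod (E ?v (- ?u)) \<le> t * (norm2 a * norm2 b)"
  proof -
    have "cmod (E ?v (- ?u)) \<le> (s * norm2 b) * (s * norm2 a)"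
      using s(1) la[of "- s"] lb[of s]
      by (intro order_trans[OF E_le] mult_mono) auto
    also have "\<dots> = (s * s) * (norm2 a * norm2 b)" by simp
    finally show ?thesis unfolding s(2) .
  qed
  have E2: "cmod (E ?u (- ?v)) \<le> t * (norm2 a * norm2 b)"
  proof -
    have "cmod (E ?u (- ?v)) \<le> (s * norm2 a) * (s * norm2 b)"
      using s(1) la[of s] lb[of "- s"]
      by (intro order_trans[OF E_le] mult_mono) auto
    also have "\<dots> = (s * s) * (norm2 a * norm2 b)" by simp
    finally show ?thesis unfolding s(2) .
  qed
  \<comment> \<open>The two orders in which the increments can be arranged; both lead to the translation by \<open>s + \<i>s\<close>.\<close>
  define P where "P = (\<integral>z. T ?v z * cnj (T (- ?u) z) \<partial>lborel)"
  define Q where "Q = (\<integral>z. T ?u z * cnj (T (- ?v) z) \<partial>lborel)"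
  have P: "P = cis (2 * pi * t) * G (?u + ?v)" and Q: "Q = cis (- (2 * pi * t)) * G (?u + ?v)"
    unfolding P_def Q_def inner using s(2) by (simp_all add: add.commute)
  have "P - Q = (2 * \<i> * of_real (sin (2 * pi * t))) * G (?u + ?v)"
    unfolding P Q by (simp add: cis.ctr complex_eq_iff algebra_simps)
  moreover have "cmod (G (?u + ?v)) = cmod P" unfolding P by (simp add: norm_mult)
  ultimately have "cmod (P - Q) = 2 * \<bar>sin (2 * pi * t)\<bar> * cmod P"
    by (simp add: norm_mult)
  moreover have "P - Q = E ?v (- ?u) - E ?u (- ?v)"
    unfolding P_def Q_def expand by simp
  then have "cmod (P - Q) \<le> 2 * (t * (norm2 a * norm2 b))"
    using norm_triangle_ineq4[of "E ?v (- ?u)" "E ?u (- ?v)"] E1 E2 by simp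
  ultimately have up: "\<bar>sin (2 * pi * t)\<bar> * cmod P \<le> t * (norm2 a * norm2 b)" by simp
  \<comment> \<open>It remains to see that \<open>P\<close> is close to \<open>\<parallel>f\<parallel>\<^sup>2\<close>.\<close>
  have near: "cmod (G v - of_real ((norm2 f)\<^sup>2)) \<le> norm2 (\<lambda>z. T v z - f z) * norm2 f" for v
  proof -
    have "G v - of_real ((norm2 f)\<^sup>2) = (\<integral>z. (T v z - f z) * cnj (f z) \<partial>lborel)"
      unfolding G_def integral_norm_square[symmetric] left_diff_distrib
      by (rule Bochner_Integration.integral_diff[symmetric]; intro square_integrable_mult_integrable square_integrable_cnj f T)
    then show ?thesis
      using Cauchy_Schwarz_norm2[OF dT square_integrable_cnj[OF f], of v] by (simp only: norm2_cnj)
  qed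
  have Gu: "cmod (G ?u - of_real ((norm2 f)\<^sup>2)) \<le> s * norm2 a * norm2 f"
    using la[of s] s(1) by (intro order_trans[OF near] mult_right_mono) auto
  have Gv: "cmod (G ?v - of_real ((norm2 f)\<^sup>2)) \<le> s * norm2 b * norm2 f"
    using lb[of s] s(1) by (intro order_trans[OF near] mult_right_mono) auto
  have "of_real ((norm2 f)\<^sup>2) = P - E ?v (- ?u) - (G ?v - of_real ((norm2 f)\<^sup>2)) - (G ?u - of_real ((norm2 f)\<^sup>2))"
    unfolding P_def expand by simp
  then have "cmod (of_real ((norm2 f)\<^sup>2)) \<le> cmod P + cmod (E ?v (- ?u))
      + cmod (G ?v - of_real ((norm2 f)\<^sup>2)) + cmod (G ?u - of_real ((norm2 f)\<^sup>2))"
    by (smt (verit) norm_triangle_ineq4)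
  then have "(norm2 f)\<^sup>2 \<le> cmod P + t * (norm2 a * norm2 b) + s * norm2 b * norm2 f + s * norm2 a * norm2 f"
    using E1 Gu Gv by (simp only: norm_of_real abs_power2)
  then have "(norm2 f)\<^sup>2 - s * ((norm2 a + norm2 b) * norm2 f) - t * (norm2 a * norm2 b) \<le> cmod P"
    by (simp add: algebra_simps)
  from mult_left_mono[OF this, of "\<bar>sin (2 * pi * t)\<bar>"] up show ?thesis
    by (simp add: s_def)
qed

text \<open>Divide the previous estimate by \<open>t\<close> and let \<open>t\<close> tend to 0; the factor \<open>sin(2\<pi>t)/t\<close> tends to
\<open>2\<pi>\<close>.\<close>

lemma uncertainty_principle:
  assumes A: "weak_mag_derivative 1 f a" and B: "weak_mag_derivative \<i> f b"
  shows "2 * pi * (norm2 f)\<^sup>2 \<le> norm2 a * norm2 b"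
proof -
  let ?L = "\<lambda>t. \<bar>sin (2 * pi * t) / t\<bar> * ((norm2 f)\<^sup>2 - sqrt t * ((norm2 a + norm2 b) * norm2 f) - t * (norm2 a * norm2 b))"
  have "((\<lambda>t. sin (2 * pi * t)) has_real_derivative 2 * pi) (at 0)"
    by (auto intro!: derivative_eq_intros)
  then have "((\<lambda>t. sin (2 * pi * t) / t) \<longlongrightarrow> 2 * pi) (at 0)"
    by (simp add: DERIV_def)
  then have sin: "((\<lambda>t. sin (2 * pi * t) / t) \<longlongrightarrow> 2 * pi) (at_right 0)"
    by (rule filterlim_mono[OF _ order_refl at_le]) simp
  have lim: "(?L \<longlongrightarrow> \<bar>2 * pi\<bar> * ((norm2 f)\<^sup>2 - sqrt 0 * ((norm2 a + norm2 b) * norm2 f) - 0 * (norm2 a * norm2 b))) (at_right 0)"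
    by (intro tendsto_mult tendsto_rabs sin tendsto_diff tendsto_const tendsto_real_sqrt tendsto_ident_at)
  have "\<forall>\<^sub>F t in at_right 0. ?L t \<le> norm2 a * norm2 b"
    using eventually_at_right_less[of "0 :: real"]
  proof eventually_elim
    case (elim t)
    then show ?case
      using commutator_estimate[OF A B elim]
      by (simp add: abs_divide pos_divide_le_eq mult_ac)
  qed
  from tendsto_upperbound[OF lim this] show ?thesis by simp
qed

section \<open>Borel representatives and the operators Z and Zbar\<close>

text \<open>Borel functions stay measurable under composition with translations and have the same
integrals for \<open>lborel\<close> and \<open>lebesgue\<close>, so the estimates are proved for Borel representatives and
transferred.\<close>

lemma borel_representative:
  assumes "in_L2 f"
  obtains f0 where "square_integrable f0" "AE z in lborel. f z = f0 z"
proof -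
  have m: "f \<in> borel_measurable lebesgue" and i: "integrable lebesgue (\<lambda>z. (cmod (f z))\<^sup>2)"
    using assms by (auto simp: in_L2_def)
  have "(\<lambda>z. Re (f z)) \<in> borel_measurable lebesgue" "(\<lambda>z. Im (f z)) \<in> borel_measurable lebesgue"
    using m by measurable
  then obtain u v where [measurable]: "u \<in> borel_measurable lborel" "v \<in> borel_measurable lborel"
    and uv: "AE z in lborel. Re (f z) = u z" "AE z in lborel. Im (f z) = v z"
    using completion_ex_borel_measurable_real by metis
  define f0 where "f0 = (\<lambda>z. of_real (u z) + \<i> * of_real (v z))"
  have f0 [measurable]: "f0 \<in> borel_measurable lborel" unfolding f0_def by measurable
  have ae: "AE z in lborel. f z = f0 z"
    using uv by eventually_elim (simp add: f0_def complex_eq_iff)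
  have m0: "(\<lambda>z. (cmod (f0 z))\<^sup>2) \<in> borel_measurable lborel" by measurable
  have "AE z in lebesgue. (cmod (f z))\<^sup>2 = (cmod (f0 z))\<^sup>2"
    by (rule AE_completion) (use ae in eventually_elim, simp)
  then have "integrable lebesgue (\<lambda>z. (cmod (f0 z))\<^sup>2)"
    using i m measurable_completion[OF m0] by (subst integrable_cong_AE[symmetric]) auto
  then have "square_integrable f0"
    using integrable_completion[OF m0] f0 by (simp add: square_integrable_def)
  then show thesis using ae by (rule that)
qed

lemma lebesgue_integral_representative:
  fixes F F0 :: "complex \<Rightarrow> 'b :: {banach, second_countable_topology}"
  assumes "F \<in> borel_measurable lebesgue" "F0 \<in> borel_measurable lborel" "AE z in lborel. F z = F0 z"
  shows "(\<integral>z. F z \<partial>lebesgue) = (\<integral>z. F0 z \<partial>lborel)"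
  using integral_cong_AE[OF assms(1) measurable_completion[OF assms(2)] AE_completion[OF assms(3)]]
    integral_completion[OF assms(2)] by simp

lemma distr_of_representative:
  assumes f: "in_L2 f" and f0: "square_integrable f0" "AE z in lborel. f z = f0 z" and \<phi>: "\<phi> \<in> borel_measurable lborel"
  shows "distr_of f \<phi> = (\<integral>z. f0 z * \<phi> z \<partial>lborel)"
  unfolding distr_of_def
proof (rule lebesgue_integral_representative)
  have "f \<in> borel_measurable lebesgue" using f by (simp add: in_L2_def)
  then show "(\<lambda>z. f z * \<phi> z) \<in> borel_measurable lebesgue"
    using measurable_completion[OF \<phi>] by measurable
  have "f0 \<in> borel_measurable lborel" using f0 by (simp add: square_integrable_def)
  then show "(\<lambda>z. f0 z * \<phi> z) \<in> borel_measurable lborel" using \<phi> by measurable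
  show "AE z in lborel. f z * \<phi> z = f0 z * \<phi> z" using f0(2) by eventually_elim simp
qed

text \<open>All that the estimate needs to know about the choice operator in \<open>integral_abs_sq\<close>.\<close>

lemma integral_abs_sq_cases:
  obtains "integral_abs_sq u = \<infinity>"
  | g where "square_integrable g" "integral_abs_sq u = ennreal ((norm2 g)\<^sup>2)"
    "\<And>\<phi>. test_function \<phi> \<Longrightarrow> u \<phi> = (\<integral>z. g z * \<phi> z \<partial>lborel)"
proof (cases "\<exists>g. L2_represents g u")
  case False
  then have "integral_abs_sq u = \<infinity>" by (simp add: integral_abs_sq_def)
  then show thesis by (rule that)
next
  case True
  define g where "g = (SOME g. L2_represents g u)"
  have "L2_represents g u" unfolding g_def using True by (rule someI_ex)
  then have g: "in_L2 g" and ug: "\<And>\<phi>. test_function \<phi> \<Longrightarrow> u \<phi> = distr_of g \<phi>"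
    by (auto simp: L2_represents_def)
  obtain g0 where g0: "square_integrable g0" "AE z in lborel. g z = g0 z" using borel_representative[OF g] .
  have "integral_abs_sq u = (\<integral>\<^sup>+z. ennreal ((cmod (g z))\<^sup>2) \<partial>lebesgue)"
    using True by (simp add: integral_abs_sq_def g_def)
  also have "\<dots> = (\<integral>\<^sup>+z. ennreal ((cmod (g0 z))\<^sup>2) \<partial>lborel)"
    unfolding nn_integral_completion
    by (rule nn_integral_cong_AE) (use g0(2) in eventually_elim, simp)
  also have "\<dots> = ennreal ((norm2 g0)\<^sup>2)"
    unfolding norm2_power2 using g0(1) by (intro nn_integral_eq_integral) (auto simp: square_integrable_def)
  finally show thesis
    using g0 ug distr_of_representative[OF g g0 test_function_measurable] by (intro that(2)) auto
qed

text \<open>Half the sum of \<open>Z\<close> and \<open>Zbar\<close> is \<open>D\<^sub>x\<close> and \<open>\<i>/2\<close> times their difference is \<open>D\<^sub>y\<close>.  Both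
identities are checked on test functions, where every pairing reduces to the pairings \<open>X\<close>, \<open>Y\<close> with
the partial derivatives and the moments \<open>Mx\<close>, \<open>My\<close>.\<close>

lemma weak_mag_derivatives_of_Z_Zbar:
  assumes f: "in_L2 f" and f0: "square_integrable f0" "AE z in lborel. f z = f0 z"
    and g: "square_integrable g"
    and gZ: "\<And>\<phi>. test_function \<phi> \<Longrightarrow> Z_op (distr_of f) \<phi> = (\<integral>z. g z * \<phi> z \<partial>lborel)"
    and h: "square_integrable h"
    and hZ: "\<And>\<phi>. test_function \<phi> \<Longrightarrow> Zbar_op (distr_of f) \<phi> = (\<integral>z. h z * \<phi> z \<partial>lborel)"
  shows "weak_mag_derivative 1 f0 (\<lambda>z. (1 / 2) * (g z + h z))"
    and "weak_mag_derivative \<i> f0 (\<lambda>z. (\<i> / 2) * (g z - h z))"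
proof -
  have sa: "square_integrable (\<lambda>z. (1 / 2) * (g z + h z))" by (intro square_integrable_scale square_integrable_add g h)
  have sb: "square_integrable (\<lambda>z. (\<i> / 2) * (g z - h z))" by (intro square_integrable_scale square_integrable_diff g h)
  have "(\<integral>z. (1 / 2) * (g z + h z) * \<phi> z \<partial>lborel) = (\<integral>z. f0 z * dual_generator 1 \<phi> z \<partial>lborel)
      \<and> (\<integral>z. (\<i> / 2) * (g z - h z) * \<phi> z \<partial>lborel) = (\<integral>z. f0 z * dual_generator \<i> \<phi> z \<partial>lborel)"
    if \<phi>: "test_function \<phi>" for \<phi>
  proof -
    note t\<phi> = test_function_square_integrable[OF \<phi>]
    have t: "test_function (partial_x \<phi>)" "test_function (partial_y \<phi>)"
        "test_function (dual_generator 1 \<phi>)" "test_function (dual_generator \<i> \<phi>)"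
      by (intro test_function_partials test_function_dual_generator \<phi>)+
    have "test_function (\<lambda>z. of_real (Im z) * \<phi> z)"
      by (intro test_function_mult \<phi> Ck_real_polynomial real_polynomial_function.intros(1) bounded_linear_Im)
    note ty = this
    have "test_function (\<lambda>z. of_real (Re z) * \<phi> z)"
      by (intro test_function_mult \<phi> Ck_real_polynomial real_polynomial_function.intros(1) bounded_linear_Re)
    note tx = this
    define X where "X = (\<integral>z. f0 z * partial_x \<phi> z \<partial>lborel)"
    define Y where "Y = (\<integral>z. f0 z * partial_y \<phi> z \<partial>lborel)"
    define Mx where "Mx = (\<integral>z. f0 z * (of_real (Re z) * \<phi> z) \<partial>lborel)"
    define My where "My = (\<integral>z. f0 z * (of_real (Im z) * \<phi> z) \<partial>lborel)"
    have int: "integrable lborel (\<lambda>z. f0 z * \<psi> z)" if "test_function \<psi>" for \<psi>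
      using that by (intro square_integrable_mult_integrable f0(1) test_function_square_integrable)
    note ints = int[OF t(1)] int[OF t(2)] int[OF tx] int[OF ty]
    have d: "distr_of f \<psi> = (\<integral>z. f0 z * \<psi> z \<partial>lborel)" if "\<psi> \<in> borel_measurable lborel" for \<psi>
      using that by (rule distr_of_representative[OF f f0])
    have [measurable]: "\<phi> \<in> borel_measurable borel" using test_function_measurable[OF \<phi>] by simp
    have [measurable]: "cnj \<in> borel_measurable borel"
      by (intro borel_measurable_continuous_onI continuous_on_cnj continuous_on_id)
    have m1: "(\<lambda>z. 2 * of_real pi * cnj z * \<phi> z) \<in> borel_measurable lborel"
      and m2: "(\<lambda>z. 2 * of_real pi * z * \<phi> z) \<in> borel_measurable lborel" by measurable
    have "distr_of f (\<lambda>z. 2 * of_real pi * cnj z * \<phi> z)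
        = (\<integral>z. 2 * of_real pi * (f0 z * (of_real (Re z) * \<phi> z)) - 2 * of_real pi * \<i> * (f0 z * (of_real (Im z) * \<phi> z)) \<partial>lborel)"
      unfolding d[OF m1] by (rule Bochner_Integration.integral_cong) (auto simp: complex_eq_iff algebra_simps)
    also have "\<dots> = 2 * of_real pi * Mx - 2 * of_real pi * \<i> * My"
      unfolding Mx_def My_def using ints by simp
    finally have c1: "distr_of f (\<lambda>z. 2 * of_real pi * cnj z * \<phi> z) = 2 * of_real pi * Mx - 2 * of_real pi * \<i> * My" .
    have "distr_of f (\<lambda>z. 2 * of_real pi * z * \<phi> z)
        = (\<integral>z. 2 * of_real pi * (f0 z * (of_real (Re z) * \<phi> z)) + 2 * of_real pi * \<i> * (f0 z * (of_real (Im z) * \<phi> z)) \<partial>lborel)"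
      unfolding d[OF m2] by (rule Bochner_Integration.integral_cong) (auto simp: complex_eq_iff algebra_simps)
    also have "\<dots> = 2 * of_real pi * Mx + 2 * of_real pi * \<i> * My"
      unfolding Mx_def My_def using ints by simp
    finally have c2: "distr_of f (\<lambda>z. 2 * of_real pi * z * \<phi> z) = 2 * of_real pi * Mx + 2 * of_real pi * \<i> * My" .
    have dX: "distr_of f (partial_x \<phi>) = X" "distr_of f (partial_y \<phi>) = Y"
      unfolding X_def Y_def by (intro d test_function_measurable t)+
    have G: "(\<integral>z. g z * \<phi> z \<partial>lborel) = - X + \<i> * Y + 2 * of_real pi * Mx - 2 * of_real pi * \<i> * My"
      unfolding gZ[OF \<phi>, symmetric] Z_op_def distr_dz_def distr_dx_def distr_dy_def distr_mult_def c1 dX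
        by (simp add: algebra_simps)
    have H: "(\<integral>z. h z * \<phi> z \<partial>lborel) = - X - \<i> * Y - 2 * of_real pi * Mx - 2 * of_real pi * \<i> * My"
      unfolding hZ[OF \<phi>, symmetric] Zbar_op_def distr_dzbar_def distr_dx_def distr_dy_def distr_mult_def c2 dX
        by (simp add: algebra_simps)
    have ig: "integrable lborel (\<lambda>z. g z * \<phi> z)" "integrable lborel (\<lambda>z. h z * \<phi> z)"
      by (intro square_integrable_mult_integrable g h t\<phi>)+
    have "(\<integral>z. (1 / 2) * (g z + h z) * \<phi> z \<partial>lborel) = (\<integral>z. (1 / 2) * (g z * \<phi> z + h z * \<phi> z) \<partial>lborel)"
      by (simp only: mult.assoc distrib_right)
    also have "\<dots> = (1 / 2) * ((\<integral>z. g z * \<phi> z \<partial>lborel) + (\<integral>z. h z * \<phi> z \<partial>lborel))"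
      using ig by (simp only: integral_mult_right_zero Bochner_Integration.integral_add)
    also have "\<dots> = - X - 2 * of_real pi * \<i> * My" by (simp add: G H)
    also have "\<dots> = (\<integral>z. - (f0 z * partial_x \<phi> z) - 2 * of_real pi * \<i> * (f0 z * (of_real (Im z) * \<phi> z)) \<partial>lborel)"
      unfolding X_def My_def using ints by simp
    also have "\<dots> = (\<integral>z. f0 z * dual_generator 1 \<phi> z \<partial>lborel)"
      by (rule Bochner_Integration.integral_cong) (auto simp: dual_generator_def algebra_simps)
    finally have a: "(\<integral>z. (1 / 2) * (g z + h z) * \<phi> z \<partial>lborel) = (\<integral>z. f0 z * dual_generator 1 \<phi> z \<partial>lborel)" .
    have "(\<integral>z. (\<i> / 2) * (g z - h z) * \<phi> z \<partial>lborel) = (\<integral>z. (\<i> / 2) * (g z * \<phi> z - h z * \<phi> z) \<partial>lborel)"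
      by (simp only: mult.assoc left_diff_distrib)
    also have "\<dots> = (\<i> / 2) * ((\<integral>z. g z * \<phi> z \<partial>lborel) - (\<integral>z. h z * \<phi> z \<partial>lborel))"
      using ig by (simp only: integral_mult_right_zero Bochner_Integration.integral_diff)
    also have "\<dots> = - Y + 2 * of_real pi * \<i> * Mx" by (simp add: G H complex_eq_iff)
    also have "\<dots> = (\<integral>z. - (f0 z * partial_y \<phi> z) + 2 * of_real pi * \<i> * (f0 z * (of_real (Re z) * \<phi> z)) \<partial>lborel)"
      unfolding Y_def Mx_def using ints by simp
    also have "\<dots> = (\<integral>z. f0 z * dual_generator \<i> \<phi> z \<partial>lborel)"
      by (rule Bochner_Integration.integral_cong) (auto simp: dual_generator_def algebra_simps)
    finally show ?thesis using a by (intro conjI)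
  qed
  then show "weak_mag_derivative 1 f0 (\<lambda>z. (1 / 2) * (g z + h z))"
    and "weak_mag_derivative \<i> f0 (\<lambda>z. (\<i> / 2) * (g z - h z))"
    using sa sb f0(1) by (auto simp: weak_mag_derivative_def)
qed

theorem theorem1p2:
  fixes f :: "complex \<Rightarrow> complex"
  assumes "in_L2 f"
  shows "integral_abs_sq (Z_op (distr_of f)) + integral_abs_sq (Zbar_op (distr_of f))
           \<ge> ennreal (8 * pi * (L2_norm f)\<^sup>2)"
proof -
  obtain f0 where f0: "square_integrable f0" "AE z in lborel. f z = f0 z" using borel_representative[OF assms] .
  have norm_f: "L2_norm f = norm2 f0"
    unfolding L2_norm_def norm2_def
  proof (rule arg_cong[of _ _ sqrt], rule lebesgue_integral_representative)
    have "f \<in> borel_measurable lebesgue" using assms by (simp add: in_L2_def)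
    then show "(\<lambda>z. (cmod (f z))\<^sup>2) \<in> borel_measurable lebesgue" by measurable
    show "(\<lambda>z. (cmod (f0 z))\<^sup>2) \<in> borel_measurable lborel"
      using f0(1) unfolding square_integrable_def by (auto dest: borel_measurable_integrable)
    show "AE z in lborel. (cmod (f z))\<^sup>2 = (cmod (f0 z))\<^sup>2" using f0(2) by eventually_elim simp
  qed
  show ?thesis
  proof (cases rule: integral_abs_sq_cases[of "Z_op (distr_of f)"])
    case 1
    then show ?thesis by simp
  next
    case (2 g)
    note g = this
    show ?thesis
    proof (cases rule: integral_abs_sq_cases[of "Zbar_op (distr_of f)"])
      case 1
      then show ?thesis by simp
    next
      case (2 h)
      note h = this
      \<comment> \<open>The magnetic derivatives \<open>D\<^sub>x f\<close> and \<open>D\<^sub>y f\<close>.\<close>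
      define a where "a = (\<lambda>z. (1 / 2) * (g z + h z))"
      define b where "b = (\<lambda>z. (\<i> / 2) * (g z - h z))"
      have wa: "weak_mag_derivative 1 f0 a" and wb: "weak_mag_derivative \<i> f0 b"
        unfolding a_def b_def
        using weak_mag_derivatives_of_Z_Zbar[OF assms f0 g(1) g(3) h(1) h(3)] by blast+
      have sa: "square_integrable a" and sb: "square_integrable b" using wa wb by (auto simp: weak_mag_derivative_def)
      have unc: "2 * pi * (norm2 f0)\<^sup>2 \<le> norm2 a * norm2 b" by (rule uncertainty_principle[OF wa wb])
      have par: "(cmod (g z))\<^sup>2 + (cmod (h z))\<^sup>2 = 2 * (cmod (a z))\<^sup>2 + 2 * (cmod (b z))\<^sup>2" for z
      proof -
        have "(cmod (a z))\<^sup>2 = (cmod (g z + h z))\<^sup>2 / 4" "(cmod (b z))\<^sup>2 = (cmod (g z - h z))\<^sup>2 / 4"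
          unfolding a_def b_def norm_mult by (simp_all add: norm_divide power_mult_distrib power_divide)
        moreover have "(cmod (g z + h z))\<^sup>2 + (cmod (g z - h z))\<^sup>2 = 2 * (cmod (g z))\<^sup>2 + 2 * (cmod (h z))\<^sup>2"
          by (simp only: cmod_power2) (simp add: power2_eq_square algebra_simps)
        ultimately show ?thesis by simp
      qed
      have "(norm2 g)\<^sup>2 + (norm2 h)\<^sup>2 = (\<integral>z. (cmod (g z))\<^sup>2 + (cmod (h z))\<^sup>2 \<partial>lborel)"
        unfolding norm2_power2 using g(1) h(1) by (simp add: square_integrable_def)
      also have "\<dots> = 2 * (norm2 a)\<^sup>2 + 2 * (norm2 b)\<^sup>2"
        unfolding par norm2_power2 using sa sb by (simp add: square_integrable_def)
      finally have "(norm2 g)\<^sup>2 + (norm2 h)\<^sup>2 = 2 * (norm2 a)\<^sup>2 + 2 * (norm2 b)\<^sup>2" .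
      moreover have "2 * (norm2 a * norm2 b) \<le> (norm2 a)\<^sup>2 + (norm2 b)\<^sup>2"
        using sum_squares_bound[of "norm2 a" "norm2 b"] by simp
      ultimately have "8 * pi * (norm2 f0)\<^sup>2 \<le> (norm2 g)\<^sup>2 + (norm2 h)\<^sup>2"
        using unc by linarith
      then show ?thesis
        unfolding norm_f g(2) h(2) by (simp add: ennreal_plus[symmetric] ennreal_leI del: ennreal_plus)
    qed
  qed
qed

end
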